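(* Let $\Gamma$ be the context $x_1:\mathbb N,\dots,x_m:\mathbb N,X_1:\mathrm{Set}(\mathbb N),\dots,X_n:\mathrm{Set}(\mathbb N)$. Let $t$ be a term of $\mathcal L$ with free variables among $x_1,\dots,x_m$, and $\phi$ a formula of $\mathcal L$ with free variables among $x_1,\dots,x_m,X_1,\dots,X_n$. Then: (1) $\Gamma\vdash\langle t\rangle:\mathbb N$ and $\Gamma\vdash\langle\phi\rangle\ \mathrm{Prop}$ are derivable in $\mathrm{LTT}_\mathrm{W}$; (2) if $\phi$ is arithmetic, then $\Gamma\vdash\langle\!\langle\phi\rangle\!\rangle\ \mathrm{prop}$ and $\Gamma\vdash V(\langle\!\langle\phi\rangle\!\rangle)=\langle\phi\rangle$ are derivable in $\mathrm{LTT}_\mathrm{W}$; (3) if $\mathrm{ACA}_0\vdash\phi$, then $\Gamma\vdash\ \Rightarrow\langle\phi\rangle$ is derivable in $\mathrm{LTT}_0$; (4) if $\mathrm{ACA}\vdash\phi$, then $\Gamma\vdash\ \Rightarrow\langle\phi\rangle$ is derivable in $\mathrm{LTT}_0^*$.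
   Context: Second order arithmetic. The language $\mathcal L$ has number variables $x,y,z,\dots$ and set variables $X,Y,Z,\dots$; terms $t::=x\mid 0\mid \mathrm S t\mid t+t\mid t\cdot t$; formulas $\phi::=t=t\mid t\in X\mid\bot\mid\phi\supset\phi\mid\forall x\phi\mid\forall X\phi$, with $\neg,\wedge,\vee,\leftrightarrow,\exists$ defined classically. A formula is arithmetic if it contains no set quantifier. $\mathrm{ACA}_0$ is the classical two-sorted theory with equality whose axioms are: $\mathrm Sx\neq0$; $\mathrm Sx=\mathrm Sy\supset x=y$; $x+0=x$; $x+\mathrm Sy=\mathrm S(x+y)$; $x\cdot0=0$; $x\cdot\mathrm Sy=x\cdot y+x$; arithmetical comprehension $\exists X\forall x(x\in X\leftrightarrow\phi)$ for each arithmetic $\phi$ in which $X$ is not free; set induction $0\in X\supset\forall x(x\in X\supset\mathrm Sx\in X)\supset\forall x.\,x\in X$. $\mathrm{ACA}$ is $\mathrm{ACA}_0$ plus $[0/x]\phi\supset\forall x(\phi\supset[\mathrm Sx/x]\phi)\supset\forall x\phi$ for every formula $\phi$. The logic-enriched type theory $\mathrm{LTT}_\mathrm{W}$. Expressions are identified up to $\alpha$-conversion; $[M/x]X$ is capture-avoiding substitution. Types: $A::=\mathbb N\mid A\times A\mid A\to A\mid U\mid T(M)\mid\mathrm{Set}(A)$. Terms: $M::=x\mid0\mid\mathrm sM\mid\mathrm E_{\mathbb N}([x]A,M,[x,y]M,M)\mid(M,M)_{A\times B}\mid\pi_1^{A\times B}(M)\mid\pi_2^{A\times B}(M)\mid\lambda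 x{:}A.M{:}B\mid M(M)_{A\to B}\mid\hat{\mathbb N}\mid M\mathbin{\hat\times}M\mid\{x:A\mid P\}$. Names of small propositions: $P::=M\mathbin{\hat=}_M M\mid\hat\bot\mid P\mathbin{\hat\supset}P\mid\hat\forall x{:}M.P\mid M\mathbin{\hat\in}_A M$. Propositions: $\phi::=M=_M M\mid\bot\mid\phi\supset\phi\mid\forall x{:}A.\phi\mid V(P)$. Abbreviations: $\neg\phi:=\phi\supset\bot$, $\phi\wedge\psi:=\neg(\phi\supset\neg\psi)$, $\phi\vee\psi:=\neg\phi\supset\psi$, $\leftrightarrow$ as usual, $\exists x{:}A.\phi:=\neg\forall x{:}A.\neg\phi$, $M\in_A N:=V(M\mathbin{\hat\in}_A N)$, and hatted analogues ($\hat\neg$ etc.) for small propositions. Contexts are $x_1{:}A_1,\dots,x_n{:}A_n$ with distinct variables. Judgements $\Gamma\vdash\mathcal J$ with $\mathcal J$ one of: $\mathrm{valid}$, $A\ \mathrm{type}$, $A=B$, $M:A$, $M=N:A$, $P\ \mathrm{prop}$, $P=Q$, $\phi\ \mathrm{Prop}$, $\phi=\psi$, $\phi_1,\dots,\phi_n\Rightarrow\psi$. Rules: (i) structural: empty context valid; $\Gamma\vdash A\ \mathrm{type}$ gives $\Gamma,x{:}A\vdash\mathrm{valid}$; declared variables have their types; the judgemental equalities are equivalence relations; typings and term equalities transfer along type equality; $\Gamma\vdash\phi_1,\dots,\phi_n\Rightarrow\phi_i$ when all $\phi_j$ are propositions; an entailed proposition may be replaced by a judgementally equal one. (ii) Formation/typing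 rules and congruence rules for every constructor: $\mathbb N$ type, $0:\mathbb N$, $\mathrm sM:\mathbb N$; if $\Gamma,x{:}\mathbb N\vdash C\ \mathrm{type}$, $\Gamma\vdash L:[0/x]C$, $\Gamma,x{:}\mathbb N,y{:}C\vdash M:[\mathrm sx/x]C$, $\Gamma\vdash N:\mathbb N$ then $\mathrm E_{\mathbb N}([x]C,L,[x,y]M,N):[N/x]C$, with $\mathrm E_{\mathbb N}([x]C,L,[x,y]M,0)=L$ and $\mathrm E_{\mathbb N}([x]C,L,[x,y]M,\mathrm sN)=[N/x,\mathrm E_{\mathbb N}([x]C,L,[x,y]M,N)/y]M$; pairs, projections with $\pi_i((M_1,M_2))=M_i$; $\lambda$-abstraction, application, $\beta$-rule; $\{x:A\mid P\}:\mathrm{Set}(A)$ when $\Gamma,x{:}A\vdash P\ \mathrm{prop}$, $M\mathbin{\hat\in}_AN\ \mathrm{prop}$ for $M:A,N:\mathrm{Set}(A)$, and $(M\mathbin{\hat\in}_A\{x:A\mid P\})=[M/x]P$; $U$ type, $T(M)$ type for $M:U$, $\hat{\mathbb N}:U$, $M\mathbin{\hat\times}N:U$ for $M,N:U$, $T(\hat{\mathbb N})=\mathbb N$, $T(M\mathbin{\hat\times}N)=T(M)\times T(N)$; $V(P)$ Prop for $P$ prop; $V(\hat\bot)=\bot$; $V(P\mathbin{\hat\supset}Q)=V(P)\supset V(Q)$; if $\Gamma,x{:}T(M)\vdash P\ \mathrm{prop}$ then $\hat\forall x{:}M.P$ prop and $V(\hat\forall x{:}M.P)=\forall x{:}T(M).V(P)$;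 for $M_1,M_2:T(N)$, $M_1=_NM_2$ is a proposition, $M_1\mathbin{\hat=}_NM_2$ prop and $V(M_1\mathbin{\hat=}_NM_2)=(M_1=_NM_2)$; $\bot$, $\phi\supset\psi$, $\forall x{:}A.\phi$ are propositions. (iii) Classical logic: $\bot$-elimination, $\supset$-introduction/elimination, double-negation elimination, $\forall$-introduction and $\forall$-elimination over any type. (iv) Equality: $\Phi\Rightarrow M=_NM$ for $M:T(N)$; (subst): from $\Gamma,x{:}T(N)\vdash\phi\ \mathrm{Prop}$, $\Gamma\vdash\Phi\Rightarrow M_1=_NM_2$, $\Gamma\vdash\Phi\Rightarrow[M_1/x]\phi$ infer $\Gamma\vdash\Phi\Rightarrow[M_2/x]\phi$. (v) $(\mathrm{eta}_\times)$: for $M:A\times B$, from $\Phi\Rightarrow[(\pi_1M,\pi_2M)/z]\phi$ infer $\Phi\Rightarrow[M/z]\phi$; $(\mathrm{eta}_\to)$: for $M:A\to B$, from $\Phi\Rightarrow[\lambda x{:}A.M(x){:}B/z]\phi$ infer $\Phi\Rightarrow[M/z]\phi$. (vi) $(\mathrm{Ind}_{\mathbb N})$: from $\Gamma,x{:}\mathbb N\vdash\phi\ \mathrm{Prop}$, $\Gamma\vdash N:\mathbb N$, $\Gamma\vdash\Phi\Rightarrow[0/x]\phi$, $\Gamma,x{:}\mathbb N\vdash\Phi,\phi\Rightarrow[\mathrm sx/x]\phi$ infer $\Gamma\vdash\Phi\Rightarrow[N/x]\phi$. $\mathrm{LTT}_0$ is obtained from $\mathrm{LTT}_\mathrm{W}$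 by: allowing the $\mathrm E_{\mathbb N}$ rules only when $C$ has the form $T(K)$; allowing $(\mathrm{Ind}_{\mathbb N})$ only when $\phi$ has the form $V(P)$; allowing (subst), $(\mathrm{eta}_\times)$, $(\mathrm{eta}_\to)$ only when no quantifier $\forall x{:}A$ in $\phi$ has $A$ containing $U$; and adding the rule $\Gamma\vdash\phi_1,\dots,\phi_n\Rightarrow\neg(0=_{\hat{\mathbb N}}\mathrm sM)$ for $\Gamma\vdash M:\mathbb N$ and propositions $\phi_i$. A proposition is analytic if every quantifier $\forall x{:}A$ in it has $A\equiv T(M)$ for some $M$ or $A\equiv\mathrm{Set}(\mathbb N)$. $\mathrm{LTT}_0^*$ is $\mathrm{LTT}_0$ with $(\mathrm{Ind}_{\mathbb N})$ allowed for every analytic $\phi$. Translation. $\langle x\rangle\equiv x$, $\langle0\rangle\equiv0$, $\langle\mathrm St\rangle\equiv\mathrm s\langle t\rangle$, $\langle s+t\rangle\equiv\langle s\rangle\ \mathtt{plus}\ \langle t\rangle$, $\langle s\cdot t\rangle\equiv\langle s\rangle\ \mathtt{times}\ \langle t\rangle$, where $M\ \mathtt{plus}\ N\equiv\mathrm E_{\mathbb N}([x]T(\hat{\mathbb N}),M,[x,y]\mathrm sy,N)$ and $M\ \mathtt{times}\ N\equiv\mathrm E_{\mathbb N}([x]T(\hat{\mathbb N}),0,[x,y]\,y\ \mathtt{plus}\ M,N)$. For arithmetic $\phi$: $\langle\!\langle s=t\rangle\!\rangle\equiv\langle s\rangle\mathbin{\hat=}_{\hat{\mathbb N}}\langle t\rangle$,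 $\langle\!\langle t\in X\rangle\!\rangle\equiv\langle t\rangle\mathbin{\hat\in}_{\mathbb N}X$, $\langle\!\langle\neg\phi\rangle\!\rangle\equiv\hat\neg\langle\!\langle\phi\rangle\!\rangle$, $\langle\!\langle\phi\supset\psi\rangle\!\rangle\equiv\langle\!\langle\phi\rangle\!\rangle\mathbin{\hat\supset}\langle\!\langle\psi\rangle\!\rangle$, $\langle\!\langle\forall x\phi\rangle\!\rangle\equiv\hat\forall x{:}\hat{\mathbb N}.\langle\!\langle\phi\rangle\!\rangle$. For all $\phi$: $\langle s=t\rangle\equiv\langle s\rangle=_{\hat{\mathbb N}}\langle t\rangle$, $\langle t\in X\rangle\equiv\langle t\rangle\in_{\mathbb N}X$, $\langle\neg\phi\rangle\equiv\neg\langle\phi\rangle$, $\langle\phi\supset\psi\rangle\equiv\langle\phi\rangle\supset\langle\psi\rangle$, $\langle\forall x\phi\rangle\equiv\forall x{:}\mathbb N.\langle\phi\rangle$, $\langle\forall X\phi\rangle\equiv\forall X{:}\mathrm{Set}(\mathbb N).\langle\phi\rangle$ (set variables of $\mathcal L$ become variables of type $\mathrm{Set}(\mathbb N)$). *)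

theory Defs
  imports Main
begin

text \<open>
  All syntax is de Bruijn indexed, so that \<open>\<alpha>\<close>-equivalent expressions are equal. Substitution is
  simultaneous; \<open>case_nat M Var\<close> is \<open>[M/x]\<close> for the most recently bound \<open>x\<close>.
\<close>

section \<open>Second order arithmetic\<close>

text \<open>Number variables and set variables have two separate index spaces.\<close>

datatype lterm =
    LVar nat
  | LZero
  | LSuc lterm
  | LAdd lterm lterm
  | LMul lterm lterm

datatype lform =
    LEq lterm lterm
  | LMem lterm nat
  | LBot
  | LImp lform lform
  | LAllN lform
  | LAllS lform

abbreviation LNot :: "lform \<Rightarrow> lform" where
  "LNot \<phi> \<equiv> LImp \<phi> LBot"

abbreviation LAnd :: "lform \<Rightarrow> lform \<Rightarrow> lform" where
  "LAnd \<phi> \<psi> \<equiv> LNot (LImp \<phi> (LNot \<psi>))"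

abbreviation LIff :: "lform \<Rightarrow> lform \<Rightarrow> lform" where
  "LIff \<phi> \<psi> \<equiv> LAnd (LImp \<phi> \<psi>) (LImp \<psi> \<phi>)"

abbreviation LExS :: "lform \<Rightarrow> lform" where
  "LExS \<phi> \<equiv> LNot (LAllS (LNot \<phi>))"

primrec fv_term :: "lterm \<Rightarrow> nat set" where
  "fv_term (LVar x) = {x}"
| "fv_term LZero = {}"
| "fv_term (LSuc t) = fv_term t"
| "fv_term (LAdd s t) = fv_term s \<union> fv_term t"
| "fv_term (LMul s t) = fv_term s \<union> fv_term t"

primrec fv_num :: "lform \<Rightarrow> nat set" where
  "fv_num (LEq s t) = fv_term s \<union> fv_term t"
| "fv_num (LMem t X) = fv_term t"
| "fv_num LBot = {}"
| "fv_num (LImp \<phi> \<psi>) = fv_num \<phi> \<union> fv_num \<psi>"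
| "fv_num (LAllN \<phi>) = {x. Suc x \<in> fv_num \<phi>}"
| "fv_num (LAllS \<phi>) = fv_num \<phi>"

primrec fv_set :: "lform \<Rightarrow> nat set" where
  "fv_set (LEq s t) = {}"
| "fv_set (LMem t X) = {X}"
| "fv_set LBot = {}"
| "fv_set (LImp \<phi> \<psi>) = fv_set \<phi> \<union> fv_set \<psi>"
| "fv_set (LAllN \<phi>) = fv_set \<phi>"
| "fv_set (LAllS \<phi>) = {X. Suc X \<in> fv_set \<phi>}"

primrec arithmetic :: "lform \<Rightarrow> bool" where
  "arithmetic (LEq s t) = True"
| "arithmetic (LMem t X) = True"
| "arithmetic LBot = True"
| "arithmetic (LImp \<phi> \<psi>) = (arithmetic \<phi> \<and> arithmetic \<psi>)"
| "arithmetic (LAllN \<phi>) = arithmetic \<phi>"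
| "arithmetic (LAllS \<phi>) = False"

primrec lsub_term :: "(nat \<Rightarrow> lterm) \<Rightarrow> lterm \<Rightarrow> lterm" where
  "lsub_term \<sigma> (LVar x) = \<sigma> x"
| "lsub_term \<sigma> LZero = LZero"
| "lsub_term \<sigma> (LSuc t) = LSuc (lsub_term \<sigma> t)"
| "lsub_term \<sigma> (LAdd s t) = LAdd (lsub_term \<sigma> s) (lsub_term \<sigma> t)"
| "lsub_term \<sigma> (LMul s t) = LMul (lsub_term \<sigma> s) (lsub_term \<sigma> t)"

definition lup :: "(nat \<Rightarrow> lterm) \<Rightarrow> nat \<Rightarrow> lterm" where
  "lup \<sigma> = case_nat (LVar 0) (\<lambda>x. lsub_term (\<lambda>k. LVar (Suc k)) (\<sigma> x))"

primrec lsub_num :: "(nat \<Rightarrow> lterm) \<Rightarrow> lform \<Rightarrow> lform" where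
  "lsub_num \<sigma> (LEq s t) = LEq (lsub_term \<sigma> s) (lsub_term \<sigma> t)"
| "lsub_num \<sigma> (LMem t X) = LMem (lsub_term \<sigma> t) X"
| "lsub_num \<sigma> LBot = LBot"
| "lsub_num \<sigma> (LImp \<phi> \<psi>) = LImp (lsub_num \<sigma> \<phi>) (lsub_num \<sigma> \<psi>)"
| "lsub_num \<sigma> (LAllN \<phi>) = LAllN (lsub_num (lup \<sigma>) \<phi>)"
| "lsub_num \<sigma> (LAllS \<phi>) = LAllS (lsub_num \<sigma> \<phi>)"

text \<open>\<open>rup\<close> extends a renaming under one binder.\<close>

definition rup :: "(nat \<Rightarrow> nat) \<Rightarrow> nat \<Rightarrow> nat" where
  "rup \<rho> = case_nat 0 (\<lambda>x. Suc (\<rho> x))"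

primrec lren_set :: "(nat \<Rightarrow> nat) \<Rightarrow> lform \<Rightarrow> lform" where
  "lren_set \<rho> (LEq s t) = LEq s t"
| "lren_set \<rho> (LMem t X) = LMem t (\<rho> X)"
| "lren_set \<rho> LBot = LBot"
| "lren_set \<rho> (LImp \<phi> \<psi>) = LImp (lren_set \<rho> \<phi>) (lren_set \<rho> \<psi>)"
| "lren_set \<rho> (LAllN \<phi>) = LAllN (lren_set \<rho> \<phi>)"
| "lren_set \<rho> (LAllS \<phi>) = LAllS (lren_set (rup \<rho>) \<phi>)"

inductive_set ACA0 :: "lform set" where
  suc_nonzero: "LNot (LEq (LSuc (LVar x)) LZero) \<in> ACA0"
| suc_inj: "LImp (LEq (LSuc (LVar x)) (LSuc (LVar y))) (LEq (LVar x) (LVar y)) \<in> ACA0"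
| add_zero: "LEq (LAdd (LVar x) LZero) (LVar x) \<in> ACA0"
| add_suc: "LEq (LAdd (LVar x) (LSuc (LVar y))) (LSuc (LAdd (LVar x) (LVar y))) \<in> ACA0"
| mul_zero: "LEq (LMul (LVar x) LZero) LZero \<in> ACA0"
| mul_suc: "LEq (LMul (LVar x) (LSuc (LVar y))) (LAdd (LMul (LVar x) (LVar y)) (LVar x)) \<in> ACA0"
| comprehension: "arithmetic \<phi> \<Longrightarrow> 0 \<notin> fv_set \<phi> \<Longrightarrow>
    LExS (LAllN (LIff (LMem (LVar 0) 0) \<phi>)) \<in> ACA0"
| set_induction:
    "LImp (LMem LZero X)
      (LImp (LAllN (LImp (LMem (LVar 0) X) (LMem (LSuc (LVar 0)) X)))
        (LAllN (LMem (LVar 0) X))) \<in> ACA0"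

definition ACA :: "lform set" where
  "ACA = ACA0 \<union>
    {LImp (lsub_num (case_nat LZero LVar) \<phi>)
      (LImp (LAllN (LImp \<phi> (lsub_num (LVar(0 := LSuc (LVar 0))) \<phi>)))
        (LAllN \<phi>)) | \<phi>. True}"

text \<open>
  Classical two-sorted natural deduction with equality between numbers: \<open>proves Ax \<Phi> \<phi>\<close> says that
  \<open>\<phi>\<close> follows from the non-logical axioms \<open>Ax\<close> under the open hypotheses \<open>\<Phi>\<close>. Free variables of axioms may be
  generalized, those of hypotheses may not.
\<close>

inductive proves :: "lform set \<Rightarrow> lform list \<Rightarrow> lform \<Rightarrow> bool" for Ax :: "lform set" where
  axm: "\<phi> \<in> Ax \<Longrightarrow> proves Ax \<Phi> \<phi>"
| hyp: "\<phi> \<in> set \<Phi> \<Longrightarrow> proves Ax \<Phi> \<phi>"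
| impI: "proves Ax (\<phi> # \<Phi>) \<psi> \<Longrightarrow> proves Ax \<Phi> (LImp \<phi> \<psi>)"
| impE: "proves Ax \<Phi> (LImp \<phi> \<psi>) \<Longrightarrow> proves Ax \<Phi> \<phi> \<Longrightarrow> proves Ax \<Phi> \<psi>"
| botE: "proves Ax \<Phi> LBot \<Longrightarrow> proves Ax \<Phi> \<phi>"
| dne: "proves Ax \<Phi> (LNot (LNot \<phi>)) \<Longrightarrow> proves Ax \<Phi> \<phi>"
| allNI: "proves Ax (map (lsub_num (\<lambda>x. LVar (Suc x))) \<Phi>) \<phi> \<Longrightarrow> proves Ax \<Phi> (LAllN \<phi>)"
| allNE: "proves Ax \<Phi> (LAllN \<phi>) \<Longrightarrow> proves Ax \<Phi> (lsub_num (case_nat t LVar) \<phi>)"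
| allSI: "proves Ax (map (lren_set Suc) \<Phi>) \<phi> \<Longrightarrow> proves Ax \<Phi> (LAllS \<phi>)"
| allSE: "proves Ax \<Phi> (LAllS \<phi>) \<Longrightarrow> proves Ax \<Phi> (lren_set (case_nat Y (\<lambda>X. X)) \<phi>)"
| eq_refl: "proves Ax \<Phi> (LEq t t)"
| eq_subst: "proves Ax \<Phi> (LEq s t) \<Longrightarrow> proves Ax \<Phi> (lsub_num (case_nat s LVar) \<phi>) \<Longrightarrow>
    proves Ax \<Phi> (lsub_num (case_nat t LVar) \<phi>)"


section \<open>Syntax of the type theories\<close>

text \<open>
  Binding structure: in \<open>EN C L M N\<close> the type \<open>C\<close> binds \<open>x\<close> (index 0), and \<open>M\<close> binds \<open>x\<close> (index 1) and
  \<open>y\<close> (index 0); \<open>Lam A M B\<close> is \<open>\<lambda>x:A.M:B\<close> and binds in \<open>M\<close> only; \<open>Compr\<close>, \<open>HAll\<close> and \<open>Forall\<close> bind in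
  their last argument.  In \<open>HEq N M\<^sub>1 M\<^sub>2\<close>, \<open>Eq N M\<^sub>1 M\<^sub>2\<close> and \<open>HMem A M N\<close> the subscript comes first.
\<close>

datatype ty =
    NatT
  | ProdT ty ty
  | ArrT ty ty
  | UT
  | T tm
  | SetT ty
and tm =
    Var nat
  | Zero
  | Sc tm
  | EN ty tm tm tm
  | PairM ty ty tm tm
  | Proj1 ty ty tm
  | Proj2 ty ty tm
  | Lam ty tm ty
  | App ty ty tm tm
  | HNat
  | HProd tm tm
  | Compr ty sprop
and sprop =
    HEq tm tm tm
  | HBot
  | HImp sprop sprop
  | HAll tm sprop
  | HMem ty tm tm

datatype prp =
    Eq tm tm tm
  | Bot
  | Imp prp prp
  | Forall ty prp
  | V sprop

abbreviation Neg :: "prp \<Rightarrow> prp" where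
  "Neg \<phi> \<equiv> Imp \<phi> Bot"

abbreviation Mem :: "ty \<Rightarrow> tm \<Rightarrow> tm \<Rightarrow> prp" where
  "Mem A M N \<equiv> V (HMem A M N)"

primrec ren_ty :: "(nat \<Rightarrow> nat) \<Rightarrow> ty \<Rightarrow> ty"
  and ren_tm :: "(nat \<Rightarrow> nat) \<Rightarrow> tm \<Rightarrow> tm"
  and ren_sp :: "(nat \<Rightarrow> nat) \<Rightarrow> sprop \<Rightarrow> sprop" where
  "ren_ty \<rho> NatT = NatT"
| "ren_ty \<rho> (ProdT A B) = ProdT (ren_ty \<rho> A) (ren_ty \<rho> B)"
| "ren_ty \<rho> (ArrT A B) = ArrT (ren_ty \<rho> A) (ren_ty \<rho> B)"
| "ren_ty \<rho> UT = UT"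
| "ren_ty \<rho> (T M) = T (ren_tm \<rho> M)"
| "ren_ty \<rho> (SetT A) = SetT (ren_ty \<rho> A)"
| "ren_tm \<rho> (Var x) = Var (\<rho> x)"
| "ren_tm \<rho> Zero = Zero"
| "ren_tm \<rho> (Sc M) = Sc (ren_tm \<rho> M)"
| "ren_tm \<rho> (EN C L M N) =
    EN (ren_ty (rup \<rho>) C) (ren_tm \<rho> L) (ren_tm (rup (rup \<rho>)) M) (ren_tm \<rho> N)"
| "ren_tm \<rho> (PairM A B M N) = PairM (ren_ty \<rho> A) (ren_ty \<rho> B) (ren_tm \<rho> M) (ren_tm \<rho> N)"
| "ren_tm \<rho> (Proj1 A B M) = Proj1 (ren_ty \<rho> A) (ren_ty \<rho> B) (ren_tm \<rho> M)"
| "ren_tm \<rho> (Proj2 A B M) = Proj2 (ren_ty \<rho> A) (ren_ty \<rho> B) (ren_tm \<rho> M)"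
| "ren_tm \<rho> (Lam A M B) = Lam (ren_ty \<rho> A) (ren_tm (rup \<rho>) M) (ren_ty \<rho> B)"
| "ren_tm \<rho> (App A B M N) = App (ren_ty \<rho> A) (ren_ty \<rho> B) (ren_tm \<rho> M) (ren_tm \<rho> N)"
| "ren_tm \<rho> HNat = HNat"
| "ren_tm \<rho> (HProd M N) = HProd (ren_tm \<rho> M) (ren_tm \<rho> N)"
| "ren_tm \<rho> (Compr A P) = Compr (ren_ty \<rho> A) (ren_sp (rup \<rho>) P)"
| "ren_sp \<rho> (HEq N M1 M2) = HEq (ren_tm \<rho> N) (ren_tm \<rho> M1) (ren_tm \<rho> M2)"
| "ren_sp \<rho> HBot = HBot"
| "ren_sp \<rho> (HImp P Q) = HImp (ren_sp \<rho> P) (ren_sp \<rho> Q)"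
| "ren_sp \<rho> (HAll M P) = HAll (ren_tm \<rho> M) (ren_sp (rup \<rho>) P)"
| "ren_sp \<rho> (HMem A M N) = HMem (ren_ty \<rho> A) (ren_tm \<rho> M) (ren_tm \<rho> N)"

primrec ren_prp :: "(nat \<Rightarrow> nat) \<Rightarrow> prp \<Rightarrow> prp" where
  "ren_prp \<rho> (Eq N M1 M2) = Eq (ren_tm \<rho> N) (ren_tm \<rho> M1) (ren_tm \<rho> M2)"
| "ren_prp \<rho> Bot = Bot"
| "ren_prp \<rho> (Imp \<phi> \<psi>) = Imp (ren_prp \<rho> \<phi>) (ren_prp \<rho> \<psi>)"
| "ren_prp \<rho> (Forall A \<phi>) = Forall (ren_ty \<rho> A) (ren_prp (rup \<rho>) \<phi>)"
| "ren_prp \<rho> (V P) = V (ren_sp \<rho> P)"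

definition up :: "(nat \<Rightarrow> tm) \<Rightarrow> nat \<Rightarrow> tm" where
  "up \<sigma> = case_nat (Var 0) (\<lambda>x. ren_tm Suc (\<sigma> x))"

primrec sub_ty :: "(nat \<Rightarrow> tm) \<Rightarrow> ty \<Rightarrow> ty"
  and sub_tm :: "(nat \<Rightarrow> tm) \<Rightarrow> tm \<Rightarrow> tm"
  and sub_sp :: "(nat \<Rightarrow> tm) \<Rightarrow> sprop \<Rightarrow> sprop" where
  "sub_ty \<sigma> NatT = NatT"
| "sub_ty \<sigma> (ProdT A B) = ProdT (sub_ty \<sigma> A) (sub_ty \<sigma> B)"
| "sub_ty \<sigma> (ArrT A B) = ArrT (sub_ty \<sigma> A) (sub_ty \<sigma> B)"
| "sub_ty \<sigma> UT = UT"
| "sub_ty \<sigma> (T M) = T (sub_tm \<sigma> M)"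
| "sub_ty \<sigma> (SetT A) = SetT (sub_ty \<sigma> A)"
| "sub_tm \<sigma> (Var x) = \<sigma> x"
| "sub_tm \<sigma> Zero = Zero"
| "sub_tm \<sigma> (Sc M) = Sc (sub_tm \<sigma> M)"
| "sub_tm \<sigma> (EN C L M N) =
    EN (sub_ty (up \<sigma>) C) (sub_tm \<sigma> L) (sub_tm (up (up \<sigma>)) M) (sub_tm \<sigma> N)"
| "sub_tm \<sigma> (PairM A B M N) = PairM (sub_ty \<sigma> A) (sub_ty \<sigma> B) (sub_tm \<sigma> M) (sub_tm \<sigma> N)"
| "sub_tm \<sigma> (Proj1 A B M) = Proj1 (sub_ty \<sigma> A) (sub_ty \<sigma> B) (sub_tm \<sigma> M)"
| "sub_tm \<sigma> (Proj2 A B M) = Proj2 (sub_ty \<sigma> A) (sub_ty \<sigma> B) (sub_tm \<sigma> M)"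
| "sub_tm \<sigma> (Lam A M B) = Lam (sub_ty \<sigma> A) (sub_tm (up \<sigma>) M) (sub_ty \<sigma> B)"
| "sub_tm \<sigma> (App A B M N) = App (sub_ty \<sigma> A) (sub_ty \<sigma> B) (sub_tm \<sigma> M) (sub_tm \<sigma> N)"
| "sub_tm \<sigma> HNat = HNat"
| "sub_tm \<sigma> (HProd M N) = HProd (sub_tm \<sigma> M) (sub_tm \<sigma> N)"
| "sub_tm \<sigma> (Compr A P) = Compr (sub_ty \<sigma> A) (sub_sp (up \<sigma>) P)"
| "sub_sp \<sigma> (HEq N M1 M2) = HEq (sub_tm \<sigma> N) (sub_tm \<sigma> M1) (sub_tm \<sigma> M2)"
| "sub_sp \<sigma> HBot = HBot"
| "sub_sp \<sigma> (HImp P Q) = HImp (sub_sp \<sigma> P) (sub_sp \<sigma> Q)"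
| "sub_sp \<sigma> (HAll M P) = HAll (sub_tm \<sigma> M) (sub_sp (up \<sigma>) P)"
| "sub_sp \<sigma> (HMem A M N) = HMem (sub_ty \<sigma> A) (sub_tm \<sigma> M) (sub_tm \<sigma> N)"

primrec sub_prp :: "(nat \<Rightarrow> tm) \<Rightarrow> prp \<Rightarrow> prp" where
  "sub_prp \<sigma> (Eq N M1 M2) = Eq (sub_tm \<sigma> N) (sub_tm \<sigma> M1) (sub_tm \<sigma> M2)"
| "sub_prp \<sigma> Bot = Bot"
| "sub_prp \<sigma> (Imp \<phi> \<psi>) = Imp (sub_prp \<sigma> \<phi>) (sub_prp \<sigma> \<psi>)"
| "sub_prp \<sigma> (Forall A \<phi>) = Forall (sub_ty \<sigma> A) (sub_prp (up \<sigma>) \<phi>)"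
| "sub_prp \<sigma> (V P) = V (sub_sp \<sigma> P)"

abbreviation inst :: "tm \<Rightarrow> nat \<Rightarrow> tm" where
  "inst M \<equiv> case_nat M Var"

text \<open>Occurrence of the symbol \<open>U\<close> anywhere, also inside type annotations of terms.\<close>

primrec U_in_ty :: "ty \<Rightarrow> bool"
  and U_in_tm :: "tm \<Rightarrow> bool"
  and U_in_sp :: "sprop \<Rightarrow> bool" where
  "U_in_ty NatT = False"
| "U_in_ty (ProdT A B) = (U_in_ty A \<or> U_in_ty B)"
| "U_in_ty (ArrT A B) = (U_in_ty A \<or> U_in_ty B)"
| "U_in_ty UT = True"
| "U_in_ty (T M) = U_in_tm M"
| "U_in_ty (SetT A) = U_in_ty A"
| "U_in_tm (Var x) = False"
| "U_in_tm Zero = False"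
| "U_in_tm (Sc M) = U_in_tm M"
| "U_in_tm (EN C L M N) = (U_in_ty C \<or> U_in_tm L \<or> U_in_tm M \<or> U_in_tm N)"
| "U_in_tm (PairM A B M N) = (U_in_ty A \<or> U_in_ty B \<or> U_in_tm M \<or> U_in_tm N)"
| "U_in_tm (Proj1 A B M) = (U_in_ty A \<or> U_in_ty B \<or> U_in_tm M)"
| "U_in_tm (Proj2 A B M) = (U_in_ty A \<or> U_in_ty B \<or> U_in_tm M)"
| "U_in_tm (Lam A M B) = (U_in_ty A \<or> U_in_tm M \<or> U_in_ty B)"
| "U_in_tm (App A B M N) = (U_in_ty A \<or> U_in_ty B \<or> U_in_tm M \<or> U_in_tm N)"
| "U_in_tm HNat = False"
| "U_in_tm (HProd M N) = (U_in_tm M \<or> U_in_tm N)"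
| "U_in_tm (Compr A P) = (U_in_ty A \<or> U_in_sp P)"
| "U_in_sp (HEq N M1 M2) = (U_in_tm N \<or> U_in_tm M1 \<or> U_in_tm M2)"
| "U_in_sp HBot = False"
| "U_in_sp (HImp P Q) = (U_in_sp P \<or> U_in_sp Q)"
| "U_in_sp (HAll M P) = (U_in_tm M \<or> U_in_sp P)"
| "U_in_sp (HMem A M N) = (U_in_ty A \<or> U_in_tm M \<or> U_in_tm N)"

primrec quantifier_types :: "prp \<Rightarrow> ty set" where
  "quantifier_types (Eq N M1 M2) = {}"
| "quantifier_types Bot = {}"
| "quantifier_types (Imp \<phi> \<psi>) = quantifier_types \<phi> \<union> quantifier_types \<psi>"
| "quantifier_types (Forall A \<phi>) = insert A (quantifier_types \<phi>)"
| "quantifier_types (V P) = {}"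

definition analytic :: "prp \<Rightarrow> bool" where
  "analytic \<phi> \<longleftrightarrow> (\<forall>A \<in> quantifier_types \<phi>. (\<exists>M. A = T M) \<or> A = SetT NatT)"


section \<open>Derivability\<close>

datatype judgement =
    Valid
  | IsType ty
  | TypeEq ty ty
  | HasType tm ty
  | TermEq tm tm ty
  | IsSmall sprop
  | SmallEq sprop sprop
  | IsProp prp
  | PropEq prp prp
  | Entails "prp list" prp

datatype system = LTT_W | LTT_0 | LTT_0_star

primrec elim_ok :: "system \<Rightarrow> ty \<Rightarrow> bool" where
  "elim_ok LTT_W C = True"
| "elim_ok LTT_0 C = (\<exists>K. C = T K)"
| "elim_ok LTT_0_star C = (\<exists>K. C = T K)"

primrec ind_ok :: "system \<Rightarrow> prp \<Rightarrow> bool" where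
  "ind_ok LTT_W \<phi> = True"
| "ind_ok LTT_0 \<phi> = (\<exists>P. \<phi> = V P)"
| "ind_ok LTT_0_star \<phi> = analytic \<phi>"

primrec subst_ok :: "system \<Rightarrow> prp \<Rightarrow> bool" where
  "subst_ok LTT_W \<phi> = True"
| "subst_ok LTT_0 \<phi> = (\<forall>A \<in> quantifier_types \<phi>. \<not> U_in_ty A)"
| "subst_ok LTT_0_star \<phi> = (\<forall>A \<in> quantifier_types \<phi>. \<not> U_in_ty A)"

text \<open>
  Contexts and hypothesis lists are extended at the head. Side conditions that a named variable is
  not free appear as weakening by \<open>Suc\<close>.
\<close>

inductive derivable :: "system \<Rightarrow> ty list \<Rightarrow> judgement \<Rightarrow> bool"
    ("(_ \<triangleright> _ \<turnstile>/ _)" [51, 51, 51] 50)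
  for S :: system where
  ctx_empty: "S \<triangleright> [] \<turnstile> Valid"
| ctx_extend: "S \<triangleright> \<Gamma> \<turnstile> IsType A \<Longrightarrow> S \<triangleright> A # \<Gamma> \<turnstile> Valid"
| var: "S \<triangleright> \<Gamma> \<turnstile> Valid \<Longrightarrow> i < length \<Gamma> \<Longrightarrow>
    S \<triangleright> \<Gamma> \<turnstile> HasType (Var i) (ren_ty (\<lambda>k. k + Suc i) (\<Gamma> ! i))"
| ty_refl: "S \<triangleright> \<Gamma> \<turnstile> IsType A \<Longrightarrow> S \<triangleright> \<Gamma> \<turnstile> TypeEq A A"
| ty_sym: "S \<triangleright> \<Gamma> \<turnstile> TypeEq A B \<Longrightarrow> S \<triangleright> \<Gamma> \<turnstile> TypeEq B A"
| ty_trans: "S \<triangleright> \<Gamma> \<turnstile> TypeEq A B \<Longrightarrow> S \<triangleright> \<Gamma> \<turnstile> TypeEq B C \<Longrightarrow> S \<triangleright> \<Gamma> \<turnstile> TypeEq A C"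
| tm_refl: "S \<triangleright> \<Gamma> \<turnstile> HasType M A \<Longrightarrow> S \<triangleright> \<Gamma> \<turnstile> TermEq M M A"
| tm_sym: "S \<triangleright> \<Gamma> \<turnstile> TermEq M N A \<Longrightarrow> S \<triangleright> \<Gamma> \<turnstile> TermEq N M A"
| tm_trans: "S \<triangleright> \<Gamma> \<turnstile> TermEq M N A \<Longrightarrow> S \<triangleright> \<Gamma> \<turnstile> TermEq N K A \<Longrightarrow> S \<triangleright> \<Gamma> \<turnstile> TermEq M K A"
| sp_refl: "S \<triangleright> \<Gamma> \<turnstile> IsSmall P \<Longrightarrow> S \<triangleright> \<Gamma> \<turnstile> SmallEq P P"
| sp_sym: "S \<triangleright> \<Gamma> \<turnstile> SmallEq P Q \<Longrightarrow> S \<triangleright> \<Gamma> \<turnstile> SmallEq Q P"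
| sp_trans: "S \<triangleright> \<Gamma> \<turnstile> SmallEq P Q \<Longrightarrow> S \<triangleright> \<Gamma> \<turnstile> SmallEq Q R \<Longrightarrow> S \<triangleright> \<Gamma> \<turnstile> SmallEq P R"
| prp_refl: "S \<triangleright> \<Gamma> \<turnstile> IsProp \<phi> \<Longrightarrow> S \<triangleright> \<Gamma> \<turnstile> PropEq \<phi> \<phi>"
| prp_sym: "S \<triangleright> \<Gamma> \<turnstile> PropEq \<phi> \<psi> \<Longrightarrow> S \<triangleright> \<Gamma> \<turnstile> PropEq \<psi> \<phi>"
| prp_trans: "S \<triangleright> \<Gamma> \<turnstile> PropEq \<phi> \<psi> \<Longrightarrow> S \<triangleright> \<Gamma> \<turnstile> PropEq \<psi> \<chi> \<Longrightarrow> S \<triangleright> \<Gamma> \<turnstile> PropEq \<phi> \<chi>"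
| tm_conv: "S \<triangleright> \<Gamma> \<turnstile> HasType M A \<Longrightarrow> S \<triangleright> \<Gamma> \<turnstile> TypeEq A B \<Longrightarrow> S \<triangleright> \<Gamma> \<turnstile> HasType M B"
| tm_eq_conv: "S \<triangleright> \<Gamma> \<turnstile> TermEq M N A \<Longrightarrow> S \<triangleright> \<Gamma> \<turnstile> TypeEq A B \<Longrightarrow> S \<triangleright> \<Gamma> \<turnstile> TermEq M N B"
| hyp: "\<forall>\<psi> \<in> set \<Phi>. S \<triangleright> \<Gamma> \<turnstile> IsProp \<psi> \<Longrightarrow> \<phi> \<in> set \<Phi> \<Longrightarrow> S \<triangleright> \<Gamma> \<turnstile> Entails \<Phi> \<phi>"
| ent_conv: "S \<triangleright> \<Gamma> \<turnstile> Entails \<Phi> \<phi> \<Longrightarrow> S \<triangleright> \<Gamma> \<turnstile> PropEq \<phi> \<psi> \<Longrightarrow> S \<triangleright> \<Gamma> \<turnstile> Entails \<Phi> \<psi>"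
| nat_form: "S \<triangleright> \<Gamma> \<turnstile> Valid \<Longrightarrow> S \<triangleright> \<Gamma> \<turnstile> IsType NatT"
| zero: "S \<triangleright> \<Gamma> \<turnstile> Valid \<Longrightarrow> S \<triangleright> \<Gamma> \<turnstile> HasType Zero NatT"
| suc: "S \<triangleright> \<Gamma> \<turnstile> HasType M NatT \<Longrightarrow> S \<triangleright> \<Gamma> \<turnstile> HasType (Sc M) NatT"
| suc_cong: "S \<triangleright> \<Gamma> \<turnstile> TermEq M M' NatT \<Longrightarrow> S \<triangleright> \<Gamma> \<turnstile> TermEq (Sc M) (Sc M') NatT"
| elim: "elim_ok S C \<Longrightarrow>
    S \<triangleright> NatT # \<Gamma> \<turnstile> IsType C \<Longrightarrow>
    S \<triangleright> \<Gamma> \<turnstile> HasType L (sub_ty (inst Zero) C) \<Longrightarrow>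
    S \<triangleright> C # NatT # \<Gamma> \<turnstile> HasType M (sub_ty (case_nat (Sc (Var 1)) (\<lambda>k. Var (k + 2))) C) \<Longrightarrow>
    S \<triangleright> \<Gamma> \<turnstile> HasType N NatT \<Longrightarrow>
    S \<triangleright> \<Gamma> \<turnstile> HasType (EN C L M N) (sub_ty (inst N) C)"
| elim_cong: "elim_ok S C \<Longrightarrow> elim_ok S C' \<Longrightarrow>
    S \<triangleright> NatT # \<Gamma> \<turnstile> TypeEq C C' \<Longrightarrow>
    S \<triangleright> \<Gamma> \<turnstile> TermEq L L' (sub_ty (inst Zero) C) \<Longrightarrow>
    S \<triangleright> C # NatT # \<Gamma> \<turnstile> TermEq M M' (sub_ty (case_nat (Sc (Var 1)) (\<lambda>k. Var (k + 2))) C) \<Longrightarrow>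
    S \<triangleright> \<Gamma> \<turnstile> TermEq N N' NatT \<Longrightarrow>
    S \<triangleright> \<Gamma> \<turnstile> TermEq (EN C L M N) (EN C' L' M' N') (sub_ty (inst N) C)"
| elim_zero: "elim_ok S C \<Longrightarrow>
    S \<triangleright> NatT # \<Gamma> \<turnstile> IsType C \<Longrightarrow>
    S \<triangleright> \<Gamma> \<turnstile> HasType L (sub_ty (inst Zero) C) \<Longrightarrow>
    S \<triangleright> C # NatT # \<Gamma> \<turnstile> HasType M (sub_ty (case_nat (Sc (Var 1)) (\<lambda>k. Var (k + 2))) C) \<Longrightarrow>
    S \<triangleright> \<Gamma> \<turnstile> TermEq (EN C L M Zero) L (sub_ty (inst Zero) C)"
| elim_suc: "elim_ok S C \<Longrightarrow>
    S \<triangleright> NatT # \<Gamma> \<turnstile> IsType C \<Longrightarrow>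
    S \<triangleright> \<Gamma> \<turnstile> HasType L (sub_ty (inst Zero) C) \<Longrightarrow>
    S \<triangleright> C # NatT # \<Gamma> \<turnstile> HasType M (sub_ty (case_nat (Sc (Var 1)) (\<lambda>k. Var (k + 2))) C) \<Longrightarrow>
    S \<triangleright> \<Gamma> \<turnstile> HasType N NatT \<Longrightarrow>
    S \<triangleright> \<Gamma> \<turnstile> TermEq (EN C L M (Sc N)) (sub_tm (case_nat (EN C L M N) (inst N)) M)
      (sub_ty (inst (Sc N)) C)"
| prod_form: "S \<triangleright> \<Gamma> \<turnstile> IsType A \<Longrightarrow> S \<triangleright> \<Gamma> \<turnstile> IsType B \<Longrightarrow> S \<triangleright> \<Gamma> \<turnstile> IsType (ProdT A B)"
| prod_cong: "S \<triangleright> \<Gamma> \<turnstile> TypeEq A A' \<Longrightarrow> S \<triangleright> \<Gamma> \<turnstile> TypeEq B B' \<Longrightarrow>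
    S \<triangleright> \<Gamma> \<turnstile> TypeEq (ProdT A B) (ProdT A' B')"
| pair: "S \<triangleright> \<Gamma> \<turnstile> HasType M A \<Longrightarrow> S \<triangleright> \<Gamma> \<turnstile> HasType N B \<Longrightarrow>
    S \<triangleright> \<Gamma> \<turnstile> HasType (PairM A B M N) (ProdT A B)"
| pair_cong: "S \<triangleright> \<Gamma> \<turnstile> TypeEq A A' \<Longrightarrow> S \<triangleright> \<Gamma> \<turnstile> TypeEq B B' \<Longrightarrow>
    S \<triangleright> \<Gamma> \<turnstile> TermEq M M' A \<Longrightarrow> S \<triangleright> \<Gamma> \<turnstile> TermEq N N' B \<Longrightarrow>
    S \<triangleright> \<Gamma> \<turnstile> TermEq (PairM A B M N) (PairM A' B' M' N') (ProdT A B)"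
| proj1: "S \<triangleright> \<Gamma> \<turnstile> HasType M (ProdT A B) \<Longrightarrow> S \<triangleright> \<Gamma> \<turnstile> HasType (Proj1 A B M) A"
| proj1_cong: "S \<triangleright> \<Gamma> \<turnstile> TypeEq A A' \<Longrightarrow> S \<triangleright> \<Gamma> \<turnstile> TypeEq B B' \<Longrightarrow>
    S \<triangleright> \<Gamma> \<turnstile> TermEq M M' (ProdT A B) \<Longrightarrow> S \<triangleright> \<Gamma> \<turnstile> TermEq (Proj1 A B M) (Proj1 A' B' M') A"
| proj1_pair: "S \<triangleright> \<Gamma> \<turnstile> HasType M A \<Longrightarrow> S \<triangleright> \<Gamma> \<turnstile> HasType N B \<Longrightarrow>
    S \<triangleright> \<Gamma> \<turnstile> TermEq (Proj1 A B (PairM A B M N)) M A"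
| proj2: "S \<triangleright> \<Gamma> \<turnstile> HasType M (ProdT A B) \<Longrightarrow> S \<triangleright> \<Gamma> \<turnstile> HasType (Proj2 A B M) B"
| proj2_cong: "S \<triangleright> \<Gamma> \<turnstile> TypeEq A A' \<Longrightarrow> S \<triangleright> \<Gamma> \<turnstile> TypeEq B B' \<Longrightarrow>
    S \<triangleright> \<Gamma> \<turnstile> TermEq M M' (ProdT A B) \<Longrightarrow> S \<triangleright> \<Gamma> \<turnstile> TermEq (Proj2 A B M) (Proj2 A' B' M') B"
| proj2_pair: "S \<triangleright> \<Gamma> \<turnstile> HasType M A \<Longrightarrow> S \<triangleright> \<Gamma> \<turnstile> HasType N B \<Longrightarrow>
    S \<triangleright> \<Gamma> \<turnstile> TermEq (Proj2 A B (PairM A B M N)) N B"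
| arr_form: "S \<triangleright> \<Gamma> \<turnstile> IsType A \<Longrightarrow> S \<triangleright> \<Gamma> \<turnstile> IsType B \<Longrightarrow> S \<triangleright> \<Gamma> \<turnstile> IsType (ArrT A B)"
| arr_cong: "S \<triangleright> \<Gamma> \<turnstile> TypeEq A A' \<Longrightarrow> S \<triangleright> \<Gamma> \<turnstile> TypeEq B B' \<Longrightarrow>
    S \<triangleright> \<Gamma> \<turnstile> TypeEq (ArrT A B) (ArrT A' B')"
| lam: "S \<triangleright> \<Gamma> \<turnstile> IsType B \<Longrightarrow> S \<triangleright> A # \<Gamma> \<turnstile> HasType M (ren_ty Suc B) \<Longrightarrow>
    S \<triangleright> \<Gamma> \<turnstile> HasType (Lam A M B) (ArrT A B)"
| lam_cong: "S \<triangleright> \<Gamma> \<turnstile> TypeEq A A' \<Longrightarrow> S \<triangleright> \<Gamma> \<turnstile> TypeEq B B' \<Longrightarrow>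
    S \<triangleright> A # \<Gamma> \<turnstile> TermEq M M' (ren_ty Suc B) \<Longrightarrow>
    S \<triangleright> \<Gamma> \<turnstile> TermEq (Lam A M B) (Lam A' M' B') (ArrT A B)"
| app: "S \<triangleright> \<Gamma> \<turnstile> HasType M (ArrT A B) \<Longrightarrow> S \<triangleright> \<Gamma> \<turnstile> HasType N A \<Longrightarrow>
    S \<triangleright> \<Gamma> \<turnstile> HasType (App A B M N) B"
| app_cong: "S \<triangleright> \<Gamma> \<turnstile> TypeEq A A' \<Longrightarrow> S \<triangleright> \<Gamma> \<turnstile> TypeEq B B' \<Longrightarrow>
    S \<triangleright> \<Gamma> \<turnstile> TermEq M M' (ArrT A B) \<Longrightarrow> S \<triangleright> \<Gamma> \<turnstile> TermEq N N' A \<Longrightarrow>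
    S \<triangleright> \<Gamma> \<turnstile> TermEq (App A B M N) (App A' B' M' N') B"
| beta: "S \<triangleright> \<Gamma> \<turnstile> IsType B \<Longrightarrow> S \<triangleright> A # \<Gamma> \<turnstile> HasType M (ren_ty Suc B) \<Longrightarrow>
    S \<triangleright> \<Gamma> \<turnstile> HasType N A \<Longrightarrow>
    S \<triangleright> \<Gamma> \<turnstile> TermEq (App A B (Lam A M B) N) (sub_tm (inst N) M) B"
| set_form: "S \<triangleright> \<Gamma> \<turnstile> IsType A \<Longrightarrow> S \<triangleright> \<Gamma> \<turnstile> IsType (SetT A)"
| set_cong: "S \<triangleright> \<Gamma> \<turnstile> TypeEq A A' \<Longrightarrow> S \<triangleright> \<Gamma> \<turnstile> TypeEq (SetT A) (SetT A')"
| compr: "S \<triangleright> A # \<Gamma> \<turnstile> IsSmall P \<Longrightarrow> S \<triangleright> \<Gamma> \<turnstile> HasType (Compr A P) (SetT A)"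
| compr_cong: "S \<triangleright> \<Gamma> \<turnstile> TypeEq A A' \<Longrightarrow> S \<triangleright> A # \<Gamma> \<turnstile> SmallEq P P' \<Longrightarrow>
    S \<triangleright> \<Gamma> \<turnstile> TermEq (Compr A P) (Compr A' P') (SetT A)"
| hmem: "S \<triangleright> \<Gamma> \<turnstile> HasType M A \<Longrightarrow> S \<triangleright> \<Gamma> \<turnstile> HasType N (SetT A) \<Longrightarrow>
    S \<triangleright> \<Gamma> \<turnstile> IsSmall (HMem A M N)"
| hmem_cong: "S \<triangleright> \<Gamma> \<turnstile> TypeEq A A' \<Longrightarrow> S \<triangleright> \<Gamma> \<turnstile> TermEq M M' A \<Longrightarrow>
    S \<triangleright> \<Gamma> \<turnstile> TermEq N N' (SetT A) \<Longrightarrow> S \<triangleright> \<Gamma> \<turnstile> SmallEq (HMem A M N) (HMem A' M' N')"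
| hmem_compr: "S \<triangleright> A # \<Gamma> \<turnstile> IsSmall P \<Longrightarrow> S \<triangleright> \<Gamma> \<turnstile> HasType M A \<Longrightarrow>
    S \<triangleright> \<Gamma> \<turnstile> SmallEq (HMem A M (Compr A P)) (sub_sp (inst M) P)"
| u_form: "S \<triangleright> \<Gamma> \<turnstile> Valid \<Longrightarrow> S \<triangleright> \<Gamma> \<turnstile> IsType UT"
| t_form: "S \<triangleright> \<Gamma> \<turnstile> HasType M UT \<Longrightarrow> S \<triangleright> \<Gamma> \<turnstile> IsType (T M)"
| t_cong: "S \<triangleright> \<Gamma> \<turnstile> TermEq M M' UT \<Longrightarrow> S \<triangleright> \<Gamma> \<turnstile> TypeEq (T M) (T M')"
| hnat: "S \<triangleright> \<Gamma> \<turnstile> Valid \<Longrightarrow> S \<triangleright> \<Gamma> \<turnstile> HasType HNat UT"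
| hprod: "S \<triangleright> \<Gamma> \<turnstile> HasType M UT \<Longrightarrow> S \<triangleright> \<Gamma> \<turnstile> HasType N UT \<Longrightarrow> S \<triangleright> \<Gamma> \<turnstile> HasType (HProd M N) UT"
| hprod_cong: "S \<triangleright> \<Gamma> \<turnstile> TermEq M M' UT \<Longrightarrow> S \<triangleright> \<Gamma> \<turnstile> TermEq N N' UT \<Longrightarrow>
    S \<triangleright> \<Gamma> \<turnstile> TermEq (HProd M N) (HProd M' N') UT"
| t_hnat: "S \<triangleright> \<Gamma> \<turnstile> Valid \<Longrightarrow> S \<triangleright> \<Gamma> \<turnstile> TypeEq (T HNat) NatT"
| t_hprod: "S \<triangleright> \<Gamma> \<turnstile> HasType M UT \<Longrightarrow> S \<triangleright> \<Gamma> \<turnstile> HasType N UT \<Longrightarrow>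
    S \<triangleright> \<Gamma> \<turnstile> TypeEq (T (HProd M N)) (ProdT (T M) (T N))"
| v_form: "S \<triangleright> \<Gamma> \<turnstile> IsSmall P \<Longrightarrow> S \<triangleright> \<Gamma> \<turnstile> IsProp (V P)"
| v_cong: "S \<triangleright> \<Gamma> \<turnstile> SmallEq P P' \<Longrightarrow> S \<triangleright> \<Gamma> \<turnstile> PropEq (V P) (V P')"
| hbot: "S \<triangleright> \<Gamma> \<turnstile> Valid \<Longrightarrow> S \<triangleright> \<Gamma> \<turnstile> IsSmall HBot"
| v_hbot: "S \<triangleright> \<Gamma> \<turnstile> Valid \<Longrightarrow> S \<triangleright> \<Gamma> \<turnstile> PropEq (V HBot) Bot"
| himp: "S \<triangleright> \<Gamma> \<turnstile> IsSmall P \<Longrightarrow> S \<triangleright> \<Gamma> \<turnstile> IsSmall Q \<Longrightarrow> S \<triangleright> \<Gamma> \<turnstile> IsSmall (HImp P Q)"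
| himp_cong: "S \<triangleright> \<Gamma> \<turnstile> SmallEq P P' \<Longrightarrow> S \<triangleright> \<Gamma> \<turnstile> SmallEq Q Q' \<Longrightarrow>
    S \<triangleright> \<Gamma> \<turnstile> SmallEq (HImp P Q) (HImp P' Q')"
| v_himp: "S \<triangleright> \<Gamma> \<turnstile> IsSmall P \<Longrightarrow> S \<triangleright> \<Gamma> \<turnstile> IsSmall Q \<Longrightarrow>
    S \<triangleright> \<Gamma> \<turnstile> PropEq (V (HImp P Q)) (Imp (V P) (V Q))"
| hall: "S \<triangleright> T M # \<Gamma> \<turnstile> IsSmall P \<Longrightarrow> S \<triangleright> \<Gamma> \<turnstile> IsSmall (HAll M P)"
| hall_cong: "S \<triangleright> \<Gamma> \<turnstile> TermEq M M' UT \<Longrightarrow> S \<triangleright> T M # \<Gamma> \<turnstile> SmallEq P P' \<Longrightarrow>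
    S \<triangleright> \<Gamma> \<turnstile> SmallEq (HAll M P) (HAll M' P')"
| v_hall: "S \<triangleright> T M # \<Gamma> \<turnstile> IsSmall P \<Longrightarrow> S \<triangleright> \<Gamma> \<turnstile> PropEq (V (HAll M P)) (Forall (T M) (V P))"
| heq: "S \<triangleright> \<Gamma> \<turnstile> HasType M1 (T N) \<Longrightarrow> S \<triangleright> \<Gamma> \<turnstile> HasType M2 (T N) \<Longrightarrow>
    S \<triangleright> \<Gamma> \<turnstile> IsSmall (HEq N M1 M2)"
| heq_cong: "S \<triangleright> \<Gamma> \<turnstile> TermEq N N' UT \<Longrightarrow> S \<triangleright> \<Gamma> \<turnstile> TermEq M1 M1' (T N) \<Longrightarrow>
    S \<triangleright> \<Gamma> \<turnstile> TermEq M2 M2' (T N) \<Longrightarrow> S \<triangleright> \<Gamma> \<turnstile> SmallEq (HEq N M1 M2) (HEq N' M1' M2')"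
| v_heq: "S \<triangleright> \<Gamma> \<turnstile> HasType M1 (T N) \<Longrightarrow> S \<triangleright> \<Gamma> \<turnstile> HasType M2 (T N) \<Longrightarrow>
    S \<triangleright> \<Gamma> \<turnstile> PropEq (V (HEq N M1 M2)) (Eq N M1 M2)"
| eq_form: "S \<triangleright> \<Gamma> \<turnstile> HasType M1 (T N) \<Longrightarrow> S \<triangleright> \<Gamma> \<turnstile> HasType M2 (T N) \<Longrightarrow>
    S \<triangleright> \<Gamma> \<turnstile> IsProp (Eq N M1 M2)"
| eq_cong: "S \<triangleright> \<Gamma> \<turnstile> TermEq N N' UT \<Longrightarrow> S \<triangleright> \<Gamma> \<turnstile> TermEq M1 M1' (T N) \<Longrightarrow>
    S \<triangleright> \<Gamma> \<turnstile> TermEq M2 M2' (T N) \<Longrightarrow> S \<triangleright> \<Gamma> \<turnstile> PropEq (Eq N M1 M2) (Eq N' M1' M2')"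
| bot_form: "S \<triangleright> \<Gamma> \<turnstile> Valid \<Longrightarrow> S \<triangleright> \<Gamma> \<turnstile> IsProp Bot"
| imp_form: "S \<triangleright> \<Gamma> \<turnstile> IsProp \<phi> \<Longrightarrow> S \<triangleright> \<Gamma> \<turnstile> IsProp \<psi> \<Longrightarrow> S \<triangleright> \<Gamma> \<turnstile> IsProp (Imp \<phi> \<psi>)"
| imp_cong: "S \<triangleright> \<Gamma> \<turnstile> PropEq \<phi> \<phi>' \<Longrightarrow> S \<triangleright> \<Gamma> \<turnstile> PropEq \<psi> \<psi>' \<Longrightarrow>
    S \<triangleright> \<Gamma> \<turnstile> PropEq (Imp \<phi> \<psi>) (Imp \<phi>' \<psi>')"
| all_form: "S \<triangleright> A # \<Gamma> \<turnstile> IsProp \<phi> \<Longrightarrow> S \<triangleright> \<Gamma> \<turnstile> IsProp (Forall A \<phi>)"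
| all_cong: "S \<triangleright> \<Gamma> \<turnstile> TypeEq A A' \<Longrightarrow> S \<triangleright> A # \<Gamma> \<turnstile> PropEq \<phi> \<phi>' \<Longrightarrow>
    S \<triangleright> \<Gamma> \<turnstile> PropEq (Forall A \<phi>) (Forall A' \<phi>')"
| botE: "S \<triangleright> \<Gamma> \<turnstile> Entails \<Phi> Bot \<Longrightarrow> S \<triangleright> \<Gamma> \<turnstile> IsProp \<phi> \<Longrightarrow> S \<triangleright> \<Gamma> \<turnstile> Entails \<Phi> \<phi>"
| impI: "S \<triangleright> \<Gamma> \<turnstile> Entails (\<phi> # \<Phi>) \<psi> \<Longrightarrow> S \<triangleright> \<Gamma> \<turnstile> Entails \<Phi> (Imp \<phi> \<psi>)"
| impE: "S \<triangleright> \<Gamma> \<turnstile> Entails \<Phi> (Imp \<phi> \<psi>) \<Longrightarrow> S \<triangleright> \<Gamma> \<turnstile> Entails \<Phi> \<phi> \<Longrightarrow> S \<triangleright> \<Gamma> \<turnstile> Entails \<Phi> \<psi>"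
| dne: "S \<triangleright> \<Gamma> \<turnstile> Entails \<Phi> (Neg (Neg \<phi>)) \<Longrightarrow> S \<triangleright> \<Gamma> \<turnstile> Entails \<Phi> \<phi>"
| allI: "\<forall>\<psi> \<in> set \<Phi>. S \<triangleright> \<Gamma> \<turnstile> IsProp \<psi> \<Longrightarrow>
    S \<triangleright> A # \<Gamma> \<turnstile> Entails (map (ren_prp Suc) \<Phi>) \<phi> \<Longrightarrow> S \<triangleright> \<Gamma> \<turnstile> Entails \<Phi> (Forall A \<phi>)"
| allE: "S \<triangleright> \<Gamma> \<turnstile> Entails \<Phi> (Forall A \<phi>) \<Longrightarrow> S \<triangleright> \<Gamma> \<turnstile> HasType M A \<Longrightarrow>
    S \<triangleright> \<Gamma> \<turnstile> Entails \<Phi> (sub_prp (inst M) \<phi>)"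
| eq_refl: "\<forall>\<psi> \<in> set \<Phi>. S \<triangleright> \<Gamma> \<turnstile> IsProp \<psi> \<Longrightarrow> S \<triangleright> \<Gamma> \<turnstile> HasType M (T N) \<Longrightarrow>
    S \<triangleright> \<Gamma> \<turnstile> Entails \<Phi> (Eq N M M)"
| subst: "subst_ok S \<phi> \<Longrightarrow>
    S \<triangleright> T N # \<Gamma> \<turnstile> IsProp \<phi> \<Longrightarrow>
    S \<triangleright> \<Gamma> \<turnstile> Entails \<Phi> (Eq N M1 M2) \<Longrightarrow>
    S \<triangleright> \<Gamma> \<turnstile> Entails \<Phi> (sub_prp (inst M1) \<phi>) \<Longrightarrow>
    S \<triangleright> \<Gamma> \<turnstile> Entails \<Phi> (sub_prp (inst M2) \<phi>)"
| eta_prod: "subst_ok S \<phi> \<Longrightarrow>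
    S \<triangleright> ProdT A B # \<Gamma> \<turnstile> IsProp \<phi> \<Longrightarrow>
    S \<triangleright> \<Gamma> \<turnstile> HasType M (ProdT A B) \<Longrightarrow>
    S \<triangleright> \<Gamma> \<turnstile> Entails \<Phi> (sub_prp (inst (PairM A B (Proj1 A B M) (Proj2 A B M))) \<phi>) \<Longrightarrow>
    S \<triangleright> \<Gamma> \<turnstile> Entails \<Phi> (sub_prp (inst M) \<phi>)"
| eta_arr: "subst_ok S \<phi> \<Longrightarrow>
    S \<triangleright> ArrT A B # \<Gamma> \<turnstile> IsProp \<phi> \<Longrightarrow>
    S \<triangleright> \<Gamma> \<turnstile> HasType M (ArrT A B) \<Longrightarrow>
    S \<triangleright> \<Gamma> \<turnstile> Entails \<Phi> (sub_prp
      (inst (Lam A (App (ren_ty Suc A) (ren_ty Suc B) (ren_tm Suc M) (Var 0)) B)) \<phi>) \<Longrightarrow>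
    S \<triangleright> \<Gamma> \<turnstile> Entails \<Phi> (sub_prp (inst M) \<phi>)"
| ind: "ind_ok S \<phi> \<Longrightarrow>
    S \<triangleright> NatT # \<Gamma> \<turnstile> IsProp \<phi> \<Longrightarrow>
    S \<triangleright> \<Gamma> \<turnstile> HasType N NatT \<Longrightarrow>
    S \<triangleright> \<Gamma> \<turnstile> Entails \<Phi> (sub_prp (inst Zero) \<phi>) \<Longrightarrow>
    S \<triangleright> NatT # \<Gamma> \<turnstile> Entails (\<phi> # map (ren_prp Suc) \<Phi>) (sub_prp (Var(0 := Sc (Var 0))) \<phi>) \<Longrightarrow>
    S \<triangleright> \<Gamma> \<turnstile> Entails \<Phi> (sub_prp (inst N) \<phi>)"
| zero_neq_suc: "S \<noteq> LTT_W \<Longrightarrow>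
    \<forall>\<psi> \<in> set \<Phi>. S \<triangleright> \<Gamma> \<turnstile> IsProp \<psi> \<Longrightarrow>
    S \<triangleright> \<Gamma> \<turnstile> HasType M NatT \<Longrightarrow>
    S \<triangleright> \<Gamma> \<turnstile> Entails \<Phi> (Neg (Eq HNat Zero (Sc M)))"


section \<open>Translation\<close>

definition plus_tm :: "tm \<Rightarrow> tm \<Rightarrow> tm" where
  "plus_tm M N = EN (T HNat) M (Sc (Var 0)) N"

definition times_tm :: "tm \<Rightarrow> tm \<Rightarrow> tm" where
  "times_tm M N = EN (T HNat) Zero (plus_tm (Var 0) (ren_tm (\<lambda>k. k + 2) M)) N"

text \<open>
  The two sorts of variables of second order arithmetic share one index space in the type theory:
  \<open>\<rho>\<close> and \<open>\<sigma>\<close> give the indices that represent number and set variables.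
\<close>

primrec tr_term :: "(nat \<Rightarrow> nat) \<Rightarrow> lterm \<Rightarrow> tm" where
  "tr_term \<rho> (LVar x) = Var (\<rho> x)"
| "tr_term \<rho> LZero = Zero"
| "tr_term \<rho> (LSuc t) = Sc (tr_term \<rho> t)"
| "tr_term \<rho> (LAdd s t) = plus_tm (tr_term \<rho> s) (tr_term \<rho> t)"
| "tr_term \<rho> (LMul s t) = times_tm (tr_term \<rho> s) (tr_term \<rho> t)"

text \<open>The small translation is meaningful for arithmetic formulas only.\<close>

primrec tr_small :: "(nat \<Rightarrow> nat) \<Rightarrow> (nat \<Rightarrow> nat) \<Rightarrow> lform \<Rightarrow> sprop" where
  "tr_small \<rho> \<sigma> (LEq s t) = HEq HNat (tr_term \<rho> s) (tr_term \<rho> t)"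
| "tr_small \<rho> \<sigma> (LMem t X) = HMem NatT (tr_term \<rho> t) (Var (\<sigma> X))"
| "tr_small \<rho> \<sigma> LBot = HBot"
| "tr_small \<rho> \<sigma> (LImp \<phi> \<psi>) = HImp (tr_small \<rho> \<sigma> \<phi>) (tr_small \<rho> \<sigma> \<psi>)"
| "tr_small \<rho> \<sigma> (LAllN \<phi>) = HAll HNat (tr_small (rup \<rho>) (Suc \<circ> \<sigma>) \<phi>)"
| "tr_small \<rho> \<sigma> (LAllS \<phi>) = undefined"

primrec tr_form :: "(nat \<Rightarrow> nat) \<Rightarrow> (nat \<Rightarrow> nat) \<Rightarrow> lform \<Rightarrow> prp" where
  "tr_form \<rho> \<sigma> (LEq s t) = Eq HNat (tr_term \<rho> s) (tr_term \<rho> t)"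
| "tr_form \<rho> \<sigma> (LMem t X) = Mem NatT (tr_term \<rho> t) (Var (\<sigma> X))"
| "tr_form \<rho> \<sigma> LBot = Bot"
| "tr_form \<rho> \<sigma> (LImp \<phi> \<psi>) = Imp (tr_form \<rho> \<sigma> \<phi>) (tr_form \<rho> \<sigma> \<psi>)"
| "tr_form \<rho> \<sigma> (LAllN \<phi>) = Forall NatT (tr_form (rup \<rho>) (Suc \<circ> \<sigma>) \<phi>)"
| "tr_form \<rho> \<sigma> (LAllS \<phi>) = Forall (SetT NatT) (tr_form (Suc \<circ> \<rho>) (rup \<sigma>) \<phi>)"

text \<open>
  The context \<open>x\<^sub>1:N, \<dots>, x\<^sub>m:N, X\<^sub>1:Set(N), \<dots>, X\<^sub>n:Set(N)\<close>: the number variable with index \<open>i < m\<close> is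
  \<open>x\<^bsub>m-i\<^esub>\<close>, found at position \<open>n + i\<close>, and the set variable with index \<open>j < n\<close> is \<open>X\<^bsub>n-j\<^esub>\<close>, found at
  position \<open>j\<close>.
\<close>

definition arith_ctx :: "nat \<Rightarrow> nat \<Rightarrow> ty list" where
  "arith_ctx m n = replicate n (SetT NatT) @ replicate m NatT"

definition num_ix :: "nat \<Rightarrow> nat \<Rightarrow> nat" where
  "num_ix n i = n + i"

definition set_ix :: "nat \<Rightarrow> nat" where
  "set_ix j = j"

end

theory Submission
  imports Defs
begin

text \<open>
  Every rule of the two-sorted calculus is matched by a rule of the type theory, provided all number
  and set variables, not only those free in the conclusion, are interpreted by variables of the
  context; since the translation commutes with substitution on the nose, no weakening or
  substitution lemma for the type theory is needed. The recursion equations hold judgementally,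
  comprehension is witnessed by \<open>{x : N | \<phi>}\<close> with the small translation of \<open>\<phi>\<close>, and set
  induction is induction for a proposition of the form \<open>V(P)\<close>.
\<close>

section \<open>Renaming and substitution\<close>

text \<open>Weakening can be avoided because a weakened translation is again a translation, of the
  same formula under shifted indices, so its typing is rederived in the longer context instead of
  being transported; in the same way an instance at a translated term is the translation of the
  instance. All variables must be interpreted because modus ponens and quantifier elimination admit
  cut formulas and instantiating terms with variables absent from the conclusion. A finite context
  can satisfy this since an interpretation need not be injective. The remaining friction is between
  \<open>NatT\<close> and \<open>T HNat\<close>, judgementally equal but distinct expressions. Small
  quantifiers, the recursion motive and substitution of equals bind variables of type
  \<open>T HNat\<close>, translated formulas bind over \<open>NatT\<close>, and no rule exchanges
  the type of a context entry; typing is therefore stated for contexts that mix both. Of the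
  successor axioms, only \<open>0 \<noteq> S x\<close> is primitive in the type theory; injectivity
  has to come from recursion.\<close>

lemma rup_simps [simp]: "rup \<rho> 0 = 0" "rup \<rho> (Suc x) = Suc (\<rho> x)"
  by (simp_all add: rup_def)

lemma up_simps [simp]: "up \<tau> 0 = Var 0" "up \<tau> (Suc x) = ren_tm Suc (\<tau> x)"
  by (simp_all add: up_def)

lemma lup_simps [simp]:
  "lup \<theta> 0 = LVar 0" "lup \<theta> (Suc x) = lsub_term (\<lambda>k. LVar (Suc k)) (\<theta> x)"
  by (simp_all add: lup_def)

lemma rup_comp: "rup r (rup s x) = rup (\<lambda>x. r (s x)) x"
  by (cases x) simp_all

lemma up_rup: "up \<tau> (rup r x) = up (\<lambda>x. \<tau> (r x)) x"
  by (cases x) simp_all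

lemma up_Var: "up (\<lambda>x. Var (r x)) = (\<lambda>x. Var (rup r x))"
proof
  fix x show "up (\<lambda>x. Var (r x)) x = Var (rup r x)" by (cases x) simp_all
qed

lemma up_id [simp]: "up Var = Var"
proof
  fix x show "up Var x = Var x" by (cases x) simp_all
qed

lemma ren_ren:
  "ren_ty r (ren_ty s A) = ren_ty (\<lambda>x. r (s x)) A"
  "ren_tm r (ren_tm s M) = ren_tm (\<lambda>x. r (s x)) M"
  "ren_sp r (ren_sp s P) = ren_sp (\<lambda>x. r (s x)) P"
  by (induction A and M and P arbitrary: r s and r s and r s rule: ty.induct tm.induct sprop.induct)
    (simp_all add: rup_comp)

lemma sub_ren:
  "sub_ty \<tau> (ren_ty r A) = sub_ty (\<lambda>x. \<tau> (r x)) A"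
  "sub_tm \<tau> (ren_tm r M) = sub_tm (\<lambda>x. \<tau> (r x)) M"
  "sub_sp \<tau> (ren_sp r P) = sub_sp (\<lambda>x. \<tau> (r x)) P"
  by (induction A and M and P arbitrary: \<tau> r and \<tau> r and \<tau> r
      rule: ty.induct tm.induct sprop.induct)
    (simp_all add: up_rup)

lemma ren_up: "ren_tm (rup r) (up \<tau> x) = up (\<lambda>x. ren_tm r (\<tau> x)) x"
  by (cases x) (simp_all add: ren_ren)

text \<open>Together with \<open>ren_ren\<close> and \<open>sub_ren\<close> this is all the
  substitution calculus required: the composition of two proper substitutions never has to be
  computed, because each one turns a translation into another translation.\<close>

lemma ren_sub:
  "ren_ty r (sub_ty \<tau> A) = sub_ty (\<lambda>x. ren_tm r (\<tau> x)) A"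
  "ren_tm r (sub_tm \<tau> M) = sub_tm (\<lambda>x. ren_tm r (\<tau> x)) M"
  "ren_sp r (sub_sp \<tau> P) = sub_sp (\<lambda>x. ren_tm r (\<tau> x)) P"
  by (induction A and M and P arbitrary: \<tau> r and \<tau> r and \<tau> r
      rule: ty.induct tm.induct sprop.induct)
    (simp_all add: ren_up)

lemma sub_Var [simp]:
  "sub_ty Var A = A" "sub_tm Var M = M" "sub_sp Var P = P"
  by (induction A and M and P rule: ty.induct tm.induct sprop.induct) simp_all

text \<open>Treating renamings as substitutions of variables lets the single law
  \<open>sub_tr_form\<close> govern weakening as well as instantiation.\<close>

lemma ren_eq_sub:
  "ren_ty r A = sub_ty (\<lambda>x. Var (r x)) A"
  "ren_tm r M = sub_tm (\<lambda>x. Var (r x)) M"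
  "ren_sp r P = sub_sp (\<lambda>x. Var (r x)) P"
  using sub_ren[of Var r] by simp_all

lemma ren_prp_eq_sub: "ren_prp r \<phi> = sub_prp (\<lambda>x. Var (r x)) \<phi>"
  by (induction \<phi> arbitrary: r) (simp_all add: ren_eq_sub up_Var)

lemma sub_plus_tm [simp]: "sub_tm \<tau> (plus_tm M N) = plus_tm (sub_tm \<tau> M) (sub_tm \<tau> N)"
  by (simp add: plus_tm_def)

text \<open>The step of the recursion contains \<open>M\<close> weakened past two binders, and
  \<open>up (up \<tau>)\<close> acts on that copy as the double weakening of \<open>\<tau>\<close>.
  This is where the mixed composition laws are needed, unlike for \<open>plus_tm\<close>.\<close>

lemma sub_times_tm [simp]: "sub_tm \<tau> (times_tm M N) = times_tm (sub_tm \<tau> M) (sub_tm \<tau> N)"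
  by (simp add: times_tm_def sub_ren ren_sub ren_ren)

lemma lsub_term_id [simp]: "lsub_term LVar t = t"
  by (induction t) simp_all

lemma lup_id [simp]: "lup LVar = LVar"
proof
  fix x show "lup LVar x = LVar x" by (cases x) simp_all
qed

lemma lsub_num_id [simp]: "lsub_num LVar \<phi> = \<phi>"
  by (induction \<phi>) simp_all

lemma rup_id [simp]: "rup (\<lambda>x. x) = (\<lambda>x. x)"
proof
  fix x show "rup (\<lambda>x. x) x = x" by (cases x) simp_all
qed

lemma lren_set_id [simp]: "lren_set (\<lambda>x. x) \<phi> = \<phi>"
  by (induction \<phi>) simp_all

section \<open>Substitution into translated terms and formulas\<close>

lemma sub_tr_term:
  assumes "\<And>x. x \<in> fv_term t \<Longrightarrow> \<tau> (\<rho> x) = tr_term \<rho>' (\<theta> x)"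
  shows "sub_tm \<tau> (tr_term \<rho> t) = tr_term \<rho>' (lsub_term \<theta> t)"
  using assms by (induction t) simp_all

lemma ren_tr_term: "ren_tm r (tr_term \<rho> t) = tr_term (\<lambda>x. r (\<rho> x)) t"
  using sub_tr_term[of t "\<lambda>x. Var (r x)" \<rho> "\<lambda>x. r (\<rho> x)" LVar] by (simp add: ren_eq_sub)

lemma up_tr_num:
  assumes "\<And>x. Suc x \<in> A \<Longrightarrow> \<tau> (\<rho> x) = tr_term \<rho>' (\<theta> x)" and "x \<in> A"
  shows "up \<tau> (rup \<rho> x) = tr_term (rup \<rho>') (lup \<theta> x)"
proof (cases x)
  case (Suc y)
  then have "\<tau> (\<rho> y) = tr_term \<rho>' (\<theta> y)" using assms by simp
  moreover have "sub_tm (\<lambda>x. Var (Suc x)) (tr_term \<rho>' (\<theta> y))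
      = tr_term (rup \<rho>') (lsub_term (\<lambda>k. LVar (Suc k)) (\<theta> y))"
    by (rule sub_tr_term) simp
  ultimately show ?thesis using Suc by (simp add: ren_eq_sub)
qed simp

lemma up_tr_set:
  assumes "\<And>X. Suc X \<in> A \<Longrightarrow> \<tau> (\<sigma> X) = Var (\<sigma>' (\<xi> X))" and "X \<in> A"
  shows "up \<tau> (rup \<sigma> X) = Var (rup \<sigma>' (rup \<xi> X))"
  using assms by (cases X) simp_all

text \<open>Weakening, instantiation of either sort and the successor substitution of induction are
  all instances, which is why \<open>\<theta>\<close> and \<open>\<xi>\<close> act together.
  Agreement is asked for at free variables only: for comprehension it fails at the bound set
  variable, and in removing dummy variables it fails at every variable outside the given
  context.\<close>

lemma sub_tr_form:
  assumes "\<And>x. x \<in> fv_num \<phi> \<Longrightarrow> \<tau> (\<rho> x) = tr_term \<rho>' (\<theta> x)"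
    and "\<And>X. X \<in> fv_set \<phi> \<Longrightarrow> \<tau> (\<sigma> X) = Var (\<sigma>' (\<xi> X))"
  shows "sub_prp \<tau> (tr_form \<rho> \<sigma> \<phi>) = tr_form \<rho>' \<sigma>' (lsub_num \<theta> (lren_set \<xi> \<phi>))"
  using assms
proof (induction \<phi> arbitrary: \<tau> \<rho> \<sigma> \<rho>' \<sigma>' \<theta> \<xi>)
  case (LAllN \<phi>)
  have "sub_prp (up \<tau>) (tr_form (rup \<rho>) (Suc \<circ> \<sigma>) \<phi>)
      = tr_form (rup \<rho>') (Suc \<circ> \<sigma>') (lsub_num (lup \<theta>) (lren_set \<xi> \<phi>))"
    using LAllN.prems by (intro LAllN.IH up_tr_num[of "fv_num \<phi>"]) simp_all
  then show ?case by simp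
next
  case (LAllS \<phi>)
  have "sub_prp (up \<tau>) (tr_form (Suc \<circ> \<rho>) (rup \<sigma>) \<phi>)
      = tr_form (Suc \<circ> \<rho>') (rup \<sigma>') (lsub_num \<theta> (lren_set (rup \<xi>) \<phi>))"
    using LAllS.prems
    by (intro LAllS.IH up_tr_set[of "fv_set \<phi>"]) (simp_all add: ren_tr_term comp_def)
  then show ?case by simp
next
  case (LImp \<phi> \<psi>)
  have "sub_prp \<tau> (tr_form \<rho> \<sigma> \<phi>) = tr_form \<rho>' \<sigma>' (lsub_num \<theta> (lren_set \<xi> \<phi>))"
    "sub_prp \<tau> (tr_form \<rho> \<sigma> \<psi>) = tr_form \<rho>' \<sigma>' (lsub_num \<theta> (lren_set \<xi> \<psi>))"
    using LImp.prems by (intro LImp.IH; simp)+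
  then show ?case by simp
qed (simp_all add: sub_tr_term)

text \<open>Variables go to variables here, since the purpose is to move the body of a comprehension
  term past one more binder.\<close>

lemma sub_tr_small:
  assumes "arithmetic \<phi>"
    and "\<And>x. \<tau> (\<rho> x) = Var (\<rho>' x)" and "\<And>X. \<tau> (\<sigma> X) = Var (\<sigma>' X)"
  shows "sub_sp \<tau> (tr_small \<rho> \<sigma> \<phi>) = tr_small \<rho>' \<sigma>' \<phi>"
  using assms
proof (induction \<phi> arbitrary: \<tau> \<rho> \<sigma> \<rho>' \<sigma>')
  case (LAllN \<phi>)
  have "sub_sp (up \<tau>) (tr_small (rup \<rho>) (Suc \<circ> \<sigma>) \<phi>) = tr_small (rup \<rho>') (Suc \<circ> \<sigma>') \<phi>"
    using LAllN.prems up_tr_num[of UNIV \<tau> \<rho> \<rho>' LVar] by (intro LAllN.IH) simp_all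
  then show ?case by simp
qed (simp_all add: sub_tr_term[where \<theta> = LVar])

section \<open>Typing of the translation\<close>

definition num_var :: "ty list \<Rightarrow> nat \<Rightarrow> bool" where
  "num_var \<Gamma> i \<longleftrightarrow> i < length \<Gamma> \<and> (\<Gamma> ! i = NatT \<or> \<Gamma> ! i = T HNat)"

definition set_var :: "ty list \<Rightarrow> nat \<Rightarrow> bool" where
  "set_var \<Gamma> i \<longleftrightarrow> i < length \<Gamma> \<and> \<Gamma> ! i = SetT NatT"

lemma num_var_Cons [simp]:
  "num_var (A # \<Gamma>) 0 \<longleftrightarrow> A = NatT \<or> A = T HNat" "num_var (A # \<Gamma>) (Suc i) \<longleftrightarrow> num_var \<Gamma> i"
  by (simp_all add: num_var_def)

lemma set_var_Cons [simp]:
  "set_var (A # \<Gamma>) 0 \<longleftrightarrow> A = SetT NatT" "set_var (A # \<Gamma>) (Suc i) \<longleftrightarrow> set_var \<Gamma> i"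
  by (simp_all add: set_var_def)

lemma num_var_rup:
  assumes "\<And>x. Suc x \<in> A \<Longrightarrow> num_var \<Gamma> (\<rho> x)" and "B = NatT \<or> B = T HNat" and "x \<in> A"
  shows "num_var (B # \<Gamma>) (rup \<rho> x)"
  using assms by (cases x) simp_all

lemma set_var_rup:
  assumes "\<And>X. Suc X \<in> A \<Longrightarrow> set_var \<Gamma> (\<sigma> X)" and "X \<in> A"
  shows "set_var (SetT NatT # \<Gamma>) (rup \<sigma> X)"
  using assms by (cases X) simp_all

lemma valid_cons:
  assumes "S \<triangleright> \<Gamma> \<turnstile> Valid"
  shows "S \<triangleright> NatT # \<Gamma> \<turnstile> Valid" "S \<triangleright> T HNat # \<Gamma> \<turnstile> Valid" "S \<triangleright> SetT NatT # \<Gamma> \<turnstile> Valid"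
  using assms by (auto intro: ctx_extend nat_form t_form hnat set_form)

lemma hasType_T_HNat_iff:
  assumes "S \<triangleright> \<Gamma> \<turnstile> Valid"
  shows "S \<triangleright> \<Gamma> \<turnstile> HasType M (T HNat) \<longleftrightarrow> S \<triangleright> \<Gamma> \<turnstile> HasType M NatT"
  using assms by (meson t_hnat tm_conv ty_sym)

lemma termEq_T_HNat_iff:
  assumes "S \<triangleright> \<Gamma> \<turnstile> Valid"
  shows "S \<triangleright> \<Gamma> \<turnstile> TermEq M N (T HNat) \<longleftrightarrow> S \<triangleright> \<Gamma> \<turnstile> TermEq M N NatT"
  using assms by (meson t_hnat tm_eq_conv ty_sym)

lemma num_var_type:
  assumes "S \<triangleright> \<Gamma> \<turnstile> Valid" "num_var \<Gamma> i"
  shows "S \<triangleright> \<Gamma> \<turnstile> HasType (Var i) NatT"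
proof -
  have "S \<triangleright> \<Gamma> \<turnstile> HasType (Var i) (ren_ty (\<lambda>k. k + Suc i) (\<Gamma> ! i))"
    using assms by (intro var) (simp_all add: num_var_def)
  then show ?thesis using assms by (auto simp: num_var_def hasType_T_HNat_iff)
qed

lemma set_var_type:
  assumes "S \<triangleright> \<Gamma> \<turnstile> Valid" "set_var \<Gamma> i"
  shows "S \<triangleright> \<Gamma> \<turnstile> HasType (Var i) (SetT NatT)"
  using var[OF assms(1), of i] assms(2) by (simp add: set_var_def)

section \<open>Recursion into small types\<close>

lemma elim_ok_T [simp]: "elim_ok S (T K)"
  by (cases S) simp_all

text \<open>A motive \<open>T K\<close> is permitted in all three systems, so recursion is available
  for arbitrary \<open>S\<close>; conversion along \<open>T HNat = NatT\<close> then hides the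
  motive from the typing.\<close>

lemma EN_type:
  assumes "S \<triangleright> \<Gamma> \<turnstile> Valid" "S \<triangleright> \<Gamma> \<turnstile> HasType L NatT"
    "S \<triangleright> T HNat # NatT # \<Gamma> \<turnstile> HasType M NatT" "S \<triangleright> \<Gamma> \<turnstile> HasType N NatT"
  shows "S \<triangleright> \<Gamma> \<turnstile> HasType (EN (T HNat) L M N) NatT"
  using elim[of S "T HNat" \<Gamma> L M N] assms
  by (simp add: hasType_T_HNat_iff valid_cons t_form hnat)

lemma EN_zero:
  assumes "S \<triangleright> \<Gamma> \<turnstile> Valid" "S \<triangleright> \<Gamma> \<turnstile> HasType L NatT"
    "S \<triangleright> T HNat # NatT # \<Gamma> \<turnstile> HasType M NatT"
  shows "S \<triangleright> \<Gamma> \<turnstile> TermEq (EN (T HNat) L M Zero) L NatT"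
  using elim_zero[of S "T HNat" \<Gamma> L M] assms
  by (simp add: hasType_T_HNat_iff termEq_T_HNat_iff valid_cons t_form hnat)

lemma EN_suc:
  assumes "S \<triangleright> \<Gamma> \<turnstile> Valid" "S \<triangleright> \<Gamma> \<turnstile> HasType L NatT"
    "S \<triangleright> T HNat # NatT # \<Gamma> \<turnstile> HasType M NatT" "S \<triangleright> \<Gamma> \<turnstile> HasType N NatT"
  shows "S \<triangleright> \<Gamma> \<turnstile> TermEq (EN (T HNat) L M (Sc N))
    (sub_tm (case_nat (EN (T HNat) L M N) (inst N)) M) NatT"
  using elim_suc[of S "T HNat" \<Gamma> L M N] assms
  by (simp add: hasType_T_HNat_iff termEq_T_HNat_iff valid_cons t_form hnat)

lemma plus_step_type:
  assumes "S \<triangleright> \<Gamma> \<turnstile> Valid"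
  shows "S \<triangleright> T HNat # NatT # \<Gamma> \<turnstile> HasType (Sc (Var 0)) NatT"
  using assms by (intro suc num_var_type valid_cons) simp_all

lemma plus_type:
  assumes "S \<triangleright> \<Gamma> \<turnstile> Valid" "S \<triangleright> \<Gamma> \<turnstile> HasType M NatT" "S \<triangleright> \<Gamma> \<turnstile> HasType N NatT"
  shows "S \<triangleright> \<Gamma> \<turnstile> HasType (plus_tm M N) NatT"
  unfolding plus_tm_def using assms by (intro EN_type plus_step_type)

lemma tr_term_type:
  assumes "S \<triangleright> \<Gamma> \<turnstile> Valid" "\<And>x. x \<in> fv_term t \<Longrightarrow> num_var \<Gamma> (\<rho> x)"
  shows "S \<triangleright> \<Gamma> \<turnstile> HasType (tr_term \<rho> t) NatT"
  using assms
proof (induction t arbitrary: \<Gamma> \<rho>)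
  case (LMul s t)
  \<comment> \<open>The copy of \<open>s\<close> in the recursion step lives under two binders.
    Since the induction generalizes over context and interpretation, its hypothesis types this copy
    directly, in place of a weakening lemma.\<close>
  have "S \<triangleright> T HNat # NatT # \<Gamma> \<turnstile> HasType (tr_term (\<lambda>x. \<rho> x + 2) s) NatT"
    using LMul.prems by (intro LMul.IH(1)) (simp_all add: valid_cons)
  with LMul show ?case
    by (auto simp: times_tm_def ren_tr_term
        intro!: EN_type plus_type zero valid_cons num_var_type)
qed (auto intro: num_var_type zero suc plus_type)

lemma tr_form_prop:
  assumes "S \<triangleright> \<Gamma> \<turnstile> Valid" "\<And>x. x \<in> fv_num \<phi> \<Longrightarrow> num_var \<Gamma> (\<rho> x)"
    "\<And>X. X \<in> fv_set \<phi> \<Longrightarrow> set_var \<Gamma> (\<sigma> X)"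
  shows "S \<triangleright> \<Gamma> \<turnstile> IsProp (tr_form \<rho> \<sigma> \<phi>)"
  using assms
proof (induction \<phi> arbitrary: \<Gamma> \<rho> \<sigma>)
  case (LEq s t)
  then show ?case by (simp add: eq_form hasType_T_HNat_iff tr_term_type)
next
  case (LMem t X)
  then show ?case by (simp add: v_form hmem tr_term_type set_var_type)
next
  case LBot
  then show ?case by (auto intro: bot_form)
next
  case (LImp \<phi> \<psi>)
  then show ?case by (auto intro!: imp_form)
next
  case (LAllN \<phi>)
  have "S \<triangleright> NatT # \<Gamma> \<turnstile> IsProp (tr_form (rup \<rho>) (Suc \<circ> \<sigma>) \<phi>)"
    using LAllN.prems by (intro LAllN.IH num_var_rup[of "fv_num \<phi>"]) (simp_all add: valid_cons)
  then show ?case by (auto intro: all_form)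
next
  case (LAllS \<phi>)
  have "S \<triangleright> SetT NatT # \<Gamma> \<turnstile> IsProp (tr_form (Suc \<circ> \<rho>) (rup \<sigma>) \<phi>)"
    using LAllS.prems by (intro LAllS.IH set_var_rup[of "fv_set \<phi>"]) (simp_all add: valid_cons)
  then show ?case by (auto intro: all_form)
qed

lemma tr_small_correct:
  assumes "arithmetic \<phi>" "S \<triangleright> \<Gamma> \<turnstile> Valid" "\<And>x. x \<in> fv_num \<phi> \<Longrightarrow> num_var \<Gamma> (\<rho> x)"
    "\<And>X. X \<in> fv_set \<phi> \<Longrightarrow> set_var \<Gamma> (\<sigma> X)"
  shows "S \<triangleright> \<Gamma> \<turnstile> IsSmall (tr_small \<rho> \<sigma> \<phi>)
    \<and> S \<triangleright> \<Gamma> \<turnstile> PropEq (V (tr_small \<rho> \<sigma> \<phi>)) (tr_form \<rho> \<sigma> \<phi>)"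
  using assms
proof (induction \<phi> arbitrary: \<Gamma> \<rho> \<sigma>)
  case (LEq s t)
  then have "S \<triangleright> \<Gamma> \<turnstile> HasType (tr_term \<rho> s) (T HNat)" "S \<triangleright> \<Gamma> \<turnstile> HasType (tr_term \<rho> t) (T HNat)"
    by (simp_all add: hasType_T_HNat_iff tr_term_type)
  then show ?case by (auto intro: heq v_heq)
next
  case (LMem t X)
  then have "S \<triangleright> \<Gamma> \<turnstile> HasType (tr_term \<rho> t) NatT" "S \<triangleright> \<Gamma> \<turnstile> HasType (Var (\<sigma> X)) (SetT NatT)"
    by (simp_all add: tr_term_type set_var_type)
  then show ?case by (auto intro: hmem prp_refl v_form)
next
  case LBot
  then show ?case by (auto intro: hbot v_hbot)
next
  case (LImp \<phi> \<psi>)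
  have "S \<triangleright> \<Gamma> \<turnstile> IsSmall (tr_small \<rho> \<sigma> \<phi>)
      \<and> S \<triangleright> \<Gamma> \<turnstile> PropEq (V (tr_small \<rho> \<sigma> \<phi>)) (tr_form \<rho> \<sigma> \<phi>)"
    "S \<triangleright> \<Gamma> \<turnstile> IsSmall (tr_small \<rho> \<sigma> \<psi>)
      \<and> S \<triangleright> \<Gamma> \<turnstile> PropEq (V (tr_small \<rho> \<sigma> \<psi>)) (tr_form \<rho> \<sigma> \<psi>)"
    using LImp.prems by (intro LImp.IH; simp)+
  then show ?case by (auto intro: himp prp_trans[OF v_himp imp_cong])
next
  case (LAllN \<phi>)
  \<comment> \<open>Unfolding \<open>V\<close> produces a quantifier over \<open>T HNat\<close>,
    which \<open>all_cong\<close> then turns into one over \<open>NatT\<close>. That rule compares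
    the bodies over the left-hand type, so the induction hypothesis is taken over
    \<open>T HNat\<close>.\<close>
  have "S \<triangleright> T HNat # \<Gamma> \<turnstile> IsSmall (tr_small (rup \<rho>) (Suc \<circ> \<sigma>) \<phi>)
      \<and> S \<triangleright> T HNat # \<Gamma> \<turnstile> PropEq (V (tr_small (rup \<rho>) (Suc \<circ> \<sigma>) \<phi>)) (tr_form (rup \<rho>) (Suc \<circ> \<sigma>) \<phi>)"
    using LAllN.prems by (intro LAllN.IH num_var_rup[of "fv_num \<phi>"]) (simp_all add: valid_cons)
  then show ?case using LAllN.prems(2)
    by (auto intro: hall prp_trans[OF v_hall all_cong] t_hnat)
qed simp

section \<open>Soundness of the translation\<close>

lemma quantifier_types_tr_form: "quantifier_types (tr_form \<rho> \<sigma> \<phi>) \<subseteq> {NatT, SetT NatT}"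
  by (induction \<phi> arbitrary: \<rho> \<sigma>) auto

lemma subst_ok_no_U:
  assumes "\<forall>A \<in> quantifier_types \<phi>. \<not> U_in_ty A"
  shows "subst_ok S \<phi>"
  using assms by (cases S) simp_all

lemma subst_ok_tr_form: "subst_ok S (tr_form \<rho> \<sigma> \<phi>)"
  using quantifier_types_tr_form[of \<rho> \<sigma> \<phi>] by (intro subst_ok_no_U) auto

text \<open>
  Translated formulas are not literally analytic, because they quantify over \<open>NatT\<close>. Replacing it by
  the judgementally equal \<open>T HNat\<close> makes them so.
\<close>

primrec small_nat :: "prp \<Rightarrow> prp" where
  "small_nat (Eq N M1 M2) = Eq N M1 M2"
| "small_nat Bot = Bot"
| "small_nat (Imp \<phi> \<psi>) = Imp (small_nat \<phi>) (small_nat \<psi>)"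
| "small_nat (Forall A \<phi>) = Forall (if A = NatT then T HNat else A) (small_nat \<phi>)"
| "small_nat (V P) = V P"

text \<open>There are no type variables, so substitution preserves the head of a type; this makes
  the test in \<open>small_nat\<close> stable under substitution.\<close>

lemma sub_ty_eq_NatT [simp]: "sub_ty \<tau> A = NatT \<longleftrightarrow> A = NatT"
  by (cases A) simp_all

lemma sub_small_nat: "sub_prp \<tau> (small_nat \<phi>) = small_nat (sub_prp \<tau> \<phi>)"
  by (induction \<phi> arbitrary: \<tau>) simp_all

lemma quantifier_types_small_nat:
  "quantifier_types (small_nat (tr_form \<rho> \<sigma> \<phi>)) \<subseteq> {T HNat, SetT NatT}"
  by (induction \<phi> arbitrary: \<rho> \<sigma>) auto

lemma analytic_small_nat: "analytic (small_nat (tr_form \<rho> \<sigma> \<phi>))"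
  using quantifier_types_small_nat[of \<rho> \<sigma> \<phi>] unfolding analytic_def by blast

section \<open>Interpretations of all variables in a context\<close>

definition env :: "system \<Rightarrow> ty list \<Rightarrow> (nat \<Rightarrow> nat) \<Rightarrow> (nat \<Rightarrow> nat) \<Rightarrow> bool" where
  "env S \<Gamma> \<rho> \<sigma> \<longleftrightarrow> S \<triangleright> \<Gamma> \<turnstile> Valid \<and> (\<forall>x. num_var \<Gamma> (\<rho> x)) \<and> (\<forall>X. set_var \<Gamma> (\<sigma> X))"

lemma env_valid: "env S \<Gamma> \<rho> \<sigma> \<Longrightarrow> S \<triangleright> \<Gamma> \<turnstile> Valid"
  by (simp add: env_def)

lemma env_num:
  assumes "env S \<Gamma> \<rho> \<sigma>"
  shows "env S (NatT # \<Gamma>) (rup \<rho>) (Suc \<circ> \<sigma>)" "env S (T HNat # \<Gamma>) (rup \<rho>) (Suc \<circ> \<sigma>)"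
  using assms num_var_rup[of UNIV \<Gamma> \<rho>] by (auto simp: env_def valid_cons)

lemma env_set:
  assumes "env S \<Gamma> \<rho> \<sigma>"
  shows "env S (SetT NatT # \<Gamma>) (Suc \<circ> \<rho>) (rup \<sigma>)"
  using assms set_var_rup[of UNIV \<Gamma> \<sigma>] by (auto simp: env_def valid_cons)

text \<open>The new entry is denoted by no variable. This is the reading of hypotheses that have
  been carried under a quantifier.\<close>

lemma env_weaken:
  assumes "env S \<Gamma> \<rho> \<sigma>"
  shows "env S (NatT # \<Gamma>) (Suc \<circ> \<rho>) (Suc \<circ> \<sigma>)"
  using assms by (auto simp: env_def valid_cons)

lemma env_term_type: "env S \<Gamma> \<rho> \<sigma> \<Longrightarrow> S \<triangleright> \<Gamma> \<turnstile> HasType (tr_term \<rho> t) NatT"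
  by (simp add: env_def tr_term_type)

lemma env_form_prop: "env S \<Gamma> \<rho> \<sigma> \<Longrightarrow> S \<triangleright> \<Gamma> \<turnstile> IsProp (tr_form \<rho> \<sigma> \<phi>)"
  by (simp add: env_def tr_form_prop)

lemma env_hyps: "env S \<Gamma> \<rho> \<sigma> \<Longrightarrow> \<forall>\<psi> \<in> set (map (tr_form \<rho> \<sigma>) \<Phi>). S \<triangleright> \<Gamma> \<turnstile> IsProp \<psi>"
  by (simp add: env_form_prop)

lemma env_small:
  assumes "arithmetic \<phi>" "env S \<Gamma> \<rho> \<sigma>"
  shows "S \<triangleright> \<Gamma> \<turnstile> IsSmall (tr_small \<rho> \<sigma> \<phi>)"
    and "S \<triangleright> \<Gamma> \<turnstile> PropEq (V (tr_small \<rho> \<sigma> \<phi>)) (tr_form \<rho> \<sigma> \<phi>)"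
  using assms tr_small_correct[of \<phi> S \<Gamma> \<rho> \<sigma>] by (simp_all add: env_def)

lemma small_nat_correct:
  assumes "env S \<Gamma> \<rho> \<sigma>"
  shows "S \<triangleright> \<Gamma> \<turnstile> IsProp (small_nat (tr_form \<rho> \<sigma> \<phi>))
    \<and> S \<triangleright> \<Gamma> \<turnstile> PropEq (tr_form \<rho> \<sigma> \<phi>) (small_nat (tr_form \<rho> \<sigma> \<phi>))"
  using assms
proof (induction \<phi> arbitrary: \<Gamma> \<rho> \<sigma>)
  case (LEq s t)
  then show ?case using env_form_prop[OF LEq, of "LEq s t"] by (simp add: prp_refl)
next
  case (LMem t X)
  then show ?case using env_form_prop[OF LMem, of "LMem t X"] by (simp add: prp_refl)
next
  case LBot
  then show ?case using env_form_prop[OF LBot, of LBot] by (simp add: prp_refl)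
next
  case (LImp \<phi> \<psi>)
  then show ?case by (simp add: imp_form imp_cong)
next
  case (LAllN \<phi>)
  \<comment> \<open>Two instances are needed: forming the new quantifier requires its body to be a
    proposition over \<open>T HNat\<close>, whereas \<open>all_cong\<close> compares the bodies over
    the original \<open>NatT\<close>.\<close>
  note T = LAllN.IH[OF env_num(2)[OF LAllN.prems]] and N = LAllN.IH[OF env_num(1)[OF LAllN.prems]]
  have "S \<triangleright> \<Gamma> \<turnstile> TypeEq NatT (T HNat)"
    using LAllN.prems by (intro ty_sym[OF t_hnat] env_valid)
  with T N show ?case by (simp add: comp_def all_form all_cong)
next
  case (LAllS \<phi>)
  have "S \<triangleright> \<Gamma> \<turnstile> TypeEq (SetT NatT) (SetT NatT)"
    using env_valid[OF LAllS.prems] by (intro ty_refl set_form nat_form)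
  with LAllS.IH[OF env_set[OF LAllS.prems]] show ?case
    by (simp add: comp_def all_form all_cong)
qed

section \<open>Translations under weakening and instantiation\<close>

lemma ren_tr_form: "ren_prp r (tr_form \<rho> \<sigma> \<phi>) = tr_form (r \<circ> \<rho>) (r \<circ> \<sigma>) \<phi>"
  using sub_tr_form[of \<phi> "\<lambda>x. Var (r x)" \<rho> "r \<circ> \<rho>" LVar \<sigma> "r \<circ> \<sigma>" "\<lambda>X. X"]
  by (simp add: ren_prp_eq_sub)

lemma map_ren_tr_form:
  "map (ren_prp Suc) (map (tr_form \<rho> \<sigma>) \<Phi>) = map (tr_form (Suc \<circ> \<rho>) (Suc \<circ> \<sigma>)) \<Phi>"
  by (simp add: ren_tr_form)

text \<open>The weakening of \<open>ren_tr_form\<close>, reread with the new entry as number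
  variable 0. The shift of hypotheses in generalization thus matches their weakening in the type
  theory.\<close>

lemma ren_tr_form_num:
  "ren_prp Suc (tr_form \<rho> \<sigma> \<phi>) = tr_form (rup \<rho>) (Suc \<circ> \<sigma>) (lsub_num (\<lambda>x. LVar (Suc x)) \<phi>)"
  using sub_tr_form[of \<phi> "\<lambda>x. Var (Suc x)" \<rho> "rup \<rho>" "\<lambda>x. LVar (Suc x)" \<sigma> "Suc \<circ> \<sigma>" "\<lambda>X. X"]
  by (simp add: ren_prp_eq_sub)

lemma ren_tr_form_set:
  "ren_prp Suc (tr_form \<rho> \<sigma> \<phi>) = tr_form (Suc \<circ> \<rho>) (rup \<sigma>) (lren_set Suc \<phi>)"
  using sub_tr_form[of \<phi> "\<lambda>x. Var (Suc x)" \<rho> "Suc \<circ> \<rho>" LVar \<sigma> "rup \<sigma>" Suc]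
  by (simp add: ren_prp_eq_sub)

lemma inst_tr_form_num:
  "sub_prp (inst (tr_term \<rho> t)) (tr_form (rup \<rho>) (Suc \<circ> \<sigma>) \<phi>)
    = tr_form \<rho> \<sigma> (lsub_num (case_nat t LVar) \<phi>)"
proof -
  have "inst (tr_term \<rho> t) (rup \<rho> x) = tr_term \<rho> (case_nat t LVar x)" for x
    by (cases x) simp_all
  then show ?thesis
    using sub_tr_form[of \<phi> "inst (tr_term \<rho> t)" "rup \<rho>" \<rho> "case_nat t LVar"
        "Suc \<circ> \<sigma>" \<sigma> "\<lambda>X. X"] by simp
qed

lemma inst_tr_form_set:
  "sub_prp (inst (Var (\<sigma> Y))) (tr_form (Suc \<circ> \<rho>) (rup \<sigma>) \<phi>)
    = tr_form \<rho> \<sigma> (lren_set (case_nat Y (\<lambda>X. X)) \<phi>)"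
proof -
  have "inst (Var (\<sigma> Y)) (rup \<sigma> X) = Var (\<sigma> (case_nat Y (\<lambda>X. X) X))" for X
    by (cases X) simp_all
  then show ?thesis
    using sub_tr_form[of \<phi> "inst (Var (\<sigma> Y))" "Suc \<circ> \<rho>" \<rho> LVar
        "rup \<sigma>" \<sigma> "case_nat Y (\<lambda>X. X)"] by simp
qed

text \<open>A universal formula weakened past a nameless entry and instantiated at that entry gives
  back its body, with the entry as the bound variable. This takes the place of choosing an
  eigenvariable.\<close>

lemma inst_Var0_tr_form:
  "sub_prp (inst (Var 0)) (tr_form (rup (Suc \<circ> \<rho>)) (Suc \<circ> (Suc \<circ> \<sigma>)) \<phi>)
    = tr_form (rup \<rho>) (Suc \<circ> \<sigma>) \<phi>"
proof -
  have "inst (Var 0) (rup (Suc \<circ> \<rho>) x) = Var (rup \<rho> x)" for x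
    by (cases x) simp_all
  then show ?thesis
    using sub_tr_form[of \<phi> "inst (Var 0)" "rup (Suc \<circ> \<rho>)" "rup \<rho>" LVar
        "Suc \<circ> (Suc \<circ> \<sigma>)" "Suc \<circ> \<sigma>" "\<lambda>X. X"] by simp
qed

lemma suc_tr_form:
  "sub_prp (Var(0 := Sc (Var 0))) (tr_form (rup \<rho>) (Suc \<circ> \<sigma>) \<phi>)
    = tr_form (rup \<rho>) (Suc \<circ> \<sigma>) (lsub_num (LVar(0 := LSuc (LVar 0))) \<phi>)"
proof -
  have "(Var(0 := Sc (Var 0))) (rup \<rho> x) = tr_term (rup \<rho>) ((LVar(0 := LSuc (LVar 0))) x)" for x
    by (cases x) simp_all
  then show ?thesis
    using sub_tr_form[of \<phi> "Var(0 := Sc (Var 0))" "rup \<rho>" "rup \<rho>" "LVar(0 := LSuc (LVar 0))"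
        "Suc \<circ> \<sigma>" "Suc \<circ> \<sigma>" "\<lambda>X. X"] by simp
qed

section \<open>Equality and the successor axioms\<close>

lemma eq_conv_right:
  assumes "S \<triangleright> \<Gamma> \<turnstile> Valid" "S \<triangleright> \<Gamma> \<turnstile> Entails \<Phi> (Eq HNat M N)" "S \<triangleright> \<Gamma> \<turnstile> HasType M NatT"
    "S \<triangleright> \<Gamma> \<turnstile> TermEq N N' NatT"
  shows "S \<triangleright> \<Gamma> \<turnstile> Entails \<Phi> (Eq HNat M N')"
  using assms by (auto intro!: ent_conv[OF assms(2)] eq_cong tm_refl hnat
      simp: hasType_T_HNat_iff termEq_T_HNat_iff)

lemma eq_of_termEq:
  assumes "S \<triangleright> \<Gamma> \<turnstile> Valid" "\<forall>\<psi> \<in> set \<Phi>. S \<triangleright> \<Gamma> \<turnstile> IsProp \<psi>" "S \<triangleright> \<Gamma> \<turnstile> HasType M NatT"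
    "S \<triangleright> \<Gamma> \<turnstile> TermEq M N NatT"
  shows "S \<triangleright> \<Gamma> \<turnstile> Entails \<Phi> (Eq HNat M N)"
  using assms by (intro eq_conv_right[OF _ derivable.eq_refl]) (simp_all add: hasType_T_HNat_iff)

text \<open>The rule \<open>zero_neq_suc\<close> refutes \<open>0 = S x\<close>, the reverse of what
  is wanted. Symmetry is not primitive, so the equation is turned around by substituting for
  \<open>z\<close> in \<open>z = S x\<close>, starting from reflexivity.\<close>

lemma suc_nonzero_sound:
  assumes "S \<noteq> LTT_W" "S \<triangleright> \<Gamma> \<turnstile> Valid" "\<forall>\<psi> \<in> set \<Phi>. S \<triangleright> \<Gamma> \<turnstile> IsProp \<psi>" "num_var \<Gamma> i"
  shows "S \<triangleright> \<Gamma> \<turnstile> Entails \<Phi> (Neg (Eq HNat (Sc (Var i)) Zero))"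
proof (rule derivable.impI)
  let ?H = "Eq HNat (Sc (Var i)) Zero"
  have i: "S \<triangleright> \<Gamma> \<turnstile> HasType (Var i) NatT"
    using assms by (simp add: num_var_type)
  have props: "\<forall>\<psi> \<in> set (?H # \<Phi>). S \<triangleright> \<Gamma> \<turnstile> IsProp \<psi>"
    using assms i by (auto intro!: eq_form suc zero simp: hasType_T_HNat_iff)
  have "S \<triangleright> \<Gamma> \<turnstile> Entails (?H # \<Phi>) (sub_prp (inst Zero) (Eq HNat (Var 0) (Sc (Var (Suc i)))))"
  proof (rule subst)
    show "S \<triangleright> T HNat # \<Gamma> \<turnstile> IsProp (Eq HNat (Var 0) (Sc (Var (Suc i))))"
      using assms by (auto intro!: eq_form suc num_var_type valid_cons
          simp: hasType_T_HNat_iff valid_cons)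
    show "S \<triangleright> \<Gamma> \<turnstile> Entails (?H # \<Phi>) ?H"
      using props by (intro derivable.hyp) simp_all
    show "S \<triangleright> \<Gamma> \<turnstile> Entails (?H # \<Phi>)
        (sub_prp (inst (Sc (Var i))) (Eq HNat (Var 0) (Sc (Var (Suc i)))))"
      using derivable.eq_refl[OF props, of "Sc (Var i)" HNat] i assms
      by (simp add: hasType_T_HNat_iff suc)
  qed (simp add: subst_ok_no_U)
  moreover have "S \<triangleright> \<Gamma> \<turnstile> Entails (?H # \<Phi>) (Neg (Eq HNat Zero (Sc (Var i))))"
    using zero_neq_suc assms(1) props i by blast
  ultimately show "S \<triangleright> \<Gamma> \<turnstile> Entails (?H # \<Phi>) Bot"
    by (auto intro: derivable.impE)
qed

lemma suc_inj_sound: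
  assumes "S \<triangleright> \<Gamma> \<turnstile> Valid" "\<forall>\<psi> \<in> set \<Phi>. S \<triangleright> \<Gamma> \<turnstile> IsProp \<psi>" "num_var \<Gamma> i" "num_var \<Gamma> j"
  shows "S \<triangleright> \<Gamma> \<turnstile> Entails \<Phi> (Imp (Eq HNat (Sc (Var i)) (Sc (Var j))) (Eq HNat (Var i) (Var j)))"
proof (rule derivable.impI)
  let ?H = "Eq HNat (Sc (Var i)) (Sc (Var j))"
  \<comment> \<open>The predecessor function: recursion into small types suffices for injectivity of \<open>Sc\<close>.\<close>
  let ?pred = "EN (T HNat) Zero (Var 1)"
  have ij: "S \<triangleright> \<Gamma> \<turnstile> HasType (Var i) NatT" "S \<triangleright> \<Gamma> \<turnstile> HasType (Var j) NatT"
    using assms by (simp_all add: num_var_type)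
  have pred_type: "S \<triangleright> \<Delta> \<turnstile> HasType (?pred N) NatT"
    if "S \<triangleright> \<Delta> \<turnstile> Valid" "S \<triangleright> \<Delta> \<turnstile> HasType N NatT" for \<Delta> N
    using that by (intro EN_type zero num_var_type valid_cons) simp_all
  have pred_suc: "S \<triangleright> \<Gamma> \<turnstile> TermEq (?pred (Sc N)) N NatT" if "S \<triangleright> \<Gamma> \<turnstile> HasType N NatT" for N
    using EN_suc[of S \<Gamma> Zero "Var 1" N] that assms(1)
    by (simp add: zero num_var_type valid_cons)
  have props: "\<forall>\<psi> \<in> set (?H # \<Phi>). S \<triangleright> \<Gamma> \<turnstile> IsProp \<psi>"
    using assms ij by (auto intro!: eq_form suc simp: hasType_T_HNat_iff)
  \<comment> \<open>Equals are substituted for \<open>z\<close> in \<open>x = pred z\<close>: at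
    \<open>z = S x\<close> it holds by computation, at \<open>z = S y\<close> it computes to
    \<open>x = y\<close>.\<close>
  have "S \<triangleright> \<Gamma> \<turnstile> Entails (?H # \<Phi>)
      (sub_prp (inst (Sc (Var j))) (Eq HNat (Var (Suc i)) (?pred (Var 0))))"
  proof (rule subst)
    show "S \<triangleright> T HNat # \<Gamma> \<turnstile> IsProp (Eq HNat (Var (Suc i)) (?pred (Var 0)))"
      using assms pred_type[of "T HNat # \<Gamma>" "Var 0"]
      by (simp add: eq_form num_var_type hasType_T_HNat_iff valid_cons)
    show "S \<triangleright> \<Gamma> \<turnstile> Entails (?H # \<Phi>) ?H"
      using props by (intro derivable.hyp) simp_all
    show "S \<triangleright> \<Gamma> \<turnstile> Entails (?H # \<Phi>)
        (sub_prp (inst (Sc (Var i))) (Eq HNat (Var (Suc i)) (?pred (Var 0))))"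
      using eq_of_termEq[OF assms(1) props ij(1) tm_sym[OF pred_suc[OF ij(1)]]]
      by (simp add: up_def)
  qed (simp add: subst_ok_no_U)
  then show "S \<triangleright> \<Gamma> \<turnstile> Entails (?H # \<Phi>) (Eq HNat (Var i) (Var j))"
    by (intro eq_conv_right[OF assms(1) _ ij(1) pred_suc[OF ij(2)]]) (simp add: up_def)
qed

text \<open>The conclusion is the classical biconditional with its conjunction unfolded; each
  direction is a hypothesis followed by conversion.\<close>

lemma iff_of_propEq:
  assumes "S \<triangleright> \<Gamma> \<turnstile> Valid" "\<forall>\<psi> \<in> set \<Phi>. S \<triangleright> \<Gamma> \<turnstile> IsProp \<psi>" "S \<triangleright> \<Gamma> \<turnstile> IsProp \<phi>"
    "S \<triangleright> \<Gamma> \<turnstile> IsProp \<psi>" "S \<triangleright> \<Gamma> \<turnstile> PropEq \<phi> \<psi>"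
  shows "S \<triangleright> \<Gamma> \<turnstile> Entails \<Phi> (Neg (Imp (Imp \<phi> \<psi>) (Neg (Imp \<psi> \<phi>))))"
proof (rule derivable.impI)
  let ?\<Phi> = "Imp (Imp \<phi> \<psi>) (Neg (Imp \<psi> \<phi>)) # \<Phi>"
  have props: "\<forall>\<psi> \<in> set ?\<Phi>. S \<triangleright> \<Gamma> \<turnstile> IsProp \<psi>"
    using assms by (auto intro!: imp_form bot_form)
  have "S \<triangleright> \<Gamma> \<turnstile> Entails ?\<Phi> (Imp \<phi> \<psi>)"
    using props assms(3) by (intro derivable.impI ent_conv[OF derivable.hyp assms(5)]) auto
  moreover have "S \<triangleright> \<Gamma> \<turnstile> Entails ?\<Phi> (Imp \<psi> \<phi>)"
    using props assms(4) by (intro derivable.impI ent_conv[OF derivable.hyp prp_sym[OF assms(5)]]) auto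
  moreover have "S \<triangleright> \<Gamma> \<turnstile> Entails ?\<Phi> (Imp (Imp \<phi> \<psi>) (Neg (Imp \<psi> \<phi>)))"
    using props by (intro derivable.hyp) simp_all
  ultimately show "S \<triangleright> \<Gamma> \<turnstile> Entails ?\<Phi> Bot"
    by (meson derivable.impE)
qed

section \<open>Comprehension\<close>

lemma comprehension_sound:
  assumes "arithmetic \<phi>" "0 \<notin> fv_set \<phi>" "env S \<Gamma> \<rho> \<sigma>"
  shows "S \<triangleright> \<Gamma> \<turnstile> Entails (map (tr_form \<rho> \<sigma>) \<Phi>)
    (tr_form \<rho> \<sigma> (LExS (LAllN (LIff (LMem (LVar 0) 0) \<phi>))))"
proof -
  let ?G = "LAllN (LIff (LMem (LVar 0) 0) \<phi>)"
  let ?\<Phi> = "LAllS (LNot ?G) # \<Phi>"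
  \<comment> \<open>The bound set variable does not occur in \<open>\<phi>\<close>, so its index may be sent anywhere.\<close>
  define \<sigma>' where "\<sigma>' X = \<sigma> (X - 1)" for X
  define P where "P = tr_small (rup \<rho>) (Suc \<circ> \<sigma>') \<phi>"
  define Q where "Q = tr_form (rup \<rho>) (Suc \<circ> \<sigma>') \<phi>"
  let ?M = "Mem NatT (Var 0) (ren_tm Suc (Compr NatT P))"
  have env': "env S \<Gamma> \<rho> \<sigma>'"
    using assms(3) by (simp add: env_def \<sigma>'_def)
  note env1 = env_num(1)[OF env']
  have valid1: "S \<triangleright> NatT # \<Gamma> \<turnstile> Valid"
    using env1 by (rule env_valid)
  have P: "S \<triangleright> NatT # \<Gamma> \<turnstile> IsSmall P" and PQ: "S \<triangleright> NatT # \<Gamma> \<turnstile> PropEq (V P) Q"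
    and Q: "S \<triangleright> NatT # \<Gamma> \<turnstile> IsProp Q"
    unfolding P_def Q_def using env_small[OF assms(1) env1] env_form_prop[OF env1] by simp_all
  \<comment> \<open>The set term is weakened past the variable of the defining condition, so its
    body is judged over two number entries, the outer of which is denoted by no variable of
    \<open>\<phi>\<close>.\<close>
  have "ren_sp (rup Suc) P = tr_small (rup (Suc \<circ> \<rho>)) (Suc \<circ> (Suc \<circ> \<sigma>')) \<phi>"
    unfolding P_def ren_eq_sub by (rule sub_tr_small[OF assms(1)]) (simp_all add: rup_comp comp_def)
  then have P1: "S \<triangleright> NatT # NatT # \<Gamma> \<turnstile> IsSmall (ren_sp (rup Suc) P)"
    using env_small(1)[OF assms(1) env_num(1)[OF env_weaken[OF env']]] by simp
  have "(\<lambda>x. inst (Var 0) (rup Suc x)) = Var"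
  proof
    fix x show "inst (Var 0) (rup Suc x) = Var x" by (cases x) simp_all
  qed
  then have inst_P: "sub_sp (inst (Var 0)) (ren_sp (rup Suc) P) = P"
    by (simp add: sub_ren)
  have var0: "S \<triangleright> NatT # \<Gamma> \<turnstile> HasType (Var 0) NatT"
    using valid1 by (simp add: num_var_type)
  have M: "S \<triangleright> NatT # \<Gamma> \<turnstile> IsProp ?M"
    using P1 var0 by (auto intro!: v_form hmem compr)
  have "S \<triangleright> NatT # \<Gamma> \<turnstile> PropEq ?M (V P)"
    using v_cong[OF hmem_compr[OF P1 var0]] inst_P by simp
  then have MQ: "S \<triangleright> NatT # \<Gamma> \<turnstile> PropEq ?M Q"
    using PQ by (rule prp_trans)
  \<comment> \<open>\<open>sub_tr_form\<close> replaces set variables by variables only, so it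
    cannot treat the atom that receives the comprehension term. It is applied to
    \<open>\<phi>\<close> alone, where the bound set variable is absent; the atom is computed
    directly in \<open>inst_G\<close>.\<close>
  have "sub_prp (up (inst (Compr NatT P))) (tr_form (rup (Suc \<circ> \<rho>)) (Suc \<circ> rup \<sigma>) \<phi>) = Q"
  proof -
    have "up (inst (Compr NatT P)) (rup (Suc \<circ> \<rho>) x) = Var (rup \<rho> x)" for x
      by (cases x) simp_all
    moreover have "up (inst (Compr NatT P)) ((Suc \<circ> rup \<sigma>) X) = Var ((Suc \<circ> \<sigma>') X)"
      if "X \<in> fv_set \<phi>" for X
      using that assms(2) by (cases X) (auto simp: \<sigma>'_def)
    ultimately show ?thesis
      unfolding Q_def
      using sub_tr_form[of \<phi> "up (inst (Compr NatT P))" "rup (Suc \<circ> \<rho>)" "rup \<rho>" LVar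
          "Suc \<circ> rup \<sigma>" "Suc \<circ> \<sigma>'" "\<lambda>X. X"] by simp
  qed
  then have inst_G: "sub_prp (inst (Compr NatT P)) (tr_form (Suc \<circ> \<rho>) (rup \<sigma>) ?G)
      = Forall NatT (Neg (Imp (Imp ?M Q) (Neg (Imp Q ?M))))" (is "_ = ?I")
    by simp
  have "S \<triangleright> \<Gamma> \<turnstile> Entails (map (tr_form \<rho> \<sigma>) ?\<Phi>) (tr_form \<rho> \<sigma> (LAllS (LNot ?G)))"
    using env_hyps[OF assms(3), of ?\<Phi>] by (rule derivable.hyp) simp
  then have "S \<triangleright> \<Gamma> \<turnstile> Entails (map (tr_form \<rho> \<sigma>) ?\<Phi>)
      (sub_prp (inst (Compr NatT P)) (tr_form (Suc \<circ> \<rho>) (rup \<sigma>) (LNot ?G)))"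
    using compr[OF P] by (intro derivable.allE) simp_all
  then have "S \<triangleright> \<Gamma> \<turnstile> Entails (map (tr_form \<rho> \<sigma>) ?\<Phi>) (Neg ?I)"
    unfolding inst_G[symmetric] by simp
  moreover have "S \<triangleright> \<Gamma> \<turnstile> Entails (map (tr_form \<rho> \<sigma>) ?\<Phi>) ?I"
  proof (rule derivable.allI[OF env_hyps[OF assms(3)]])
    show "S \<triangleright> NatT # \<Gamma> \<turnstile> Entails (map (ren_prp Suc) (map (tr_form \<rho> \<sigma>) ?\<Phi>))
        (Neg (Imp (Imp ?M Q) (Neg (Imp Q ?M))))"
      unfolding map_ren_tr_form
      by (rule iff_of_propEq[OF valid1 env_hyps[OF env_weaken[OF assms(3)]] M Q MQ])
  qed
  ultimately have "S \<triangleright> \<Gamma> \<turnstile> Entails (map (tr_form \<rho> \<sigma>) ?\<Phi>) Bot"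
    by (rule derivable.impE)
  then show ?thesis by (auto intro: derivable.impI)
qed

section \<open>Induction\<close>

abbreviation ind_base :: "lform \<Rightarrow> lform" where
  "ind_base \<phi> \<equiv> lsub_num (case_nat LZero LVar) \<phi>"

abbreviation ind_step :: "lform \<Rightarrow> lform" where
  "ind_step \<phi> \<equiv> LAllN (LImp \<phi> (lsub_num (LVar(0 := LSuc (LVar 0))) \<phi>))"

text \<open>Induction is carried out on the \<open>small_nat\<close> form, and hypotheses are
  converted into it. On a membership \<open>small_nat\<close> is the identity, so the same argument
  serves set induction in \<open>LTT_0\<close> and full induction in
  \<open>LTT_0_star\<close>.\<close>

lemma induction_inst:
  assumes ok: "ind_ok S (small_nat (tr_form (rup \<rho>) (Suc \<circ> \<sigma>) \<phi>))"
    and env: "env S \<Gamma> \<rho> \<sigma>" and N: "S \<triangleright> \<Gamma> \<turnstile> HasType N NatT"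
    and hyps: "ind_base \<phi> \<in> set \<Phi>" "ind_step \<phi> \<in> set \<Phi>"
  shows "S \<triangleright> \<Gamma> \<turnstile> Entails (map (tr_form \<rho> \<sigma>) \<Phi>)
    (small_nat (sub_prp (inst N) (tr_form (rup \<rho>) (Suc \<circ> \<sigma>) \<phi>)))"
proof -
  define Q where "Q = tr_form (rup \<rho>) (Suc \<circ> \<sigma>) \<phi>"
  define Q' where "Q' = tr_form (rup \<rho>) (Suc \<circ> \<sigma>) (lsub_num (LVar(0 := LSuc (LVar 0))) \<phi>)"
  \<comment> \<open>The same new entry is read in two ways: the hypotheses ignore it, while
    \<open>Q\<close> has it as induction variable.\<close>
  let ?\<Psi> = "small_nat Q # map (tr_form (Suc \<circ> \<rho>) (Suc \<circ> \<sigma>)) \<Phi>"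
  note env1 = env_num(1)[OF env]
  have Q: "S \<triangleright> NatT # \<Gamma> \<turnstile> IsProp (small_nat Q)" "S \<triangleright> NatT # \<Gamma> \<turnstile> PropEq Q (small_nat Q)"
    and Q': "S \<triangleright> NatT # \<Gamma> \<turnstile> PropEq Q' (small_nat Q')"
    using small_nat_correct[OF env1] by (simp_all add: Q_def Q'_def)
  have props: "\<forall>\<psi> \<in> set ?\<Psi>. S \<triangleright> NatT # \<Gamma> \<turnstile> IsProp \<psi>"
    using Q(1) env_hyps[OF env_weaken[OF env]] by simp
  have "S \<triangleright> NatT # \<Gamma> \<turnstile> Entails ?\<Psi> (tr_form (Suc \<circ> \<rho>) (Suc \<circ> \<sigma>) (ind_step \<phi>))"
    using props hyps(2) by (intro derivable.hyp) (auto simp del: tr_form.simps)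
  moreover have "S \<triangleright> NatT # \<Gamma> \<turnstile> HasType (Var 0) NatT"
    using env_valid[OF env1] by (rule num_var_type) simp
  ultimately have "S \<triangleright> NatT # \<Gamma> \<turnstile> Entails ?\<Psi>
      (sub_prp (inst (Var 0)) (tr_form (rup (Suc \<circ> \<rho>)) (Suc \<circ> (Suc \<circ> \<sigma>))
        (LImp \<phi> (lsub_num (LVar(0 := LSuc (LVar 0))) \<phi>))))"
    unfolding tr_form.simps(5) by (rule derivable.allE)
  then have "S \<triangleright> NatT # \<Gamma> \<turnstile> Entails ?\<Psi> (Imp Q Q')"
    unfolding inst_Var0_tr_form by (simp add: Q_def Q'_def)
  moreover have "S \<triangleright> NatT # \<Gamma> \<turnstile> Entails ?\<Psi> Q"
    using props prp_sym[OF Q(2)] by (intro ent_conv[OF derivable.hyp]) simp_all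
  ultimately have step: "S \<triangleright> NatT # \<Gamma> \<turnstile> Entails ?\<Psi> (small_nat Q')"
    using Q' by (blast intro: ent_conv derivable.impE)
  have base: "S \<triangleright> \<Gamma> \<turnstile> Entails (map (tr_form \<rho> \<sigma>) \<Phi>) (small_nat (tr_form \<rho> \<sigma> (ind_base \<phi>)))"
    using hyps(1) env_hyps[OF env] small_nat_correct[OF env]
    by (intro ent_conv[OF derivable.hyp]) auto
  show ?thesis
    unfolding Q_def[symmetric] sub_small_nat[symmetric]
  proof (rule ind[OF _ Q(1) N])
    show "ind_ok S (small_nat Q)"
      using ok by (simp add: Q_def)
    show "S \<triangleright> \<Gamma> \<turnstile> Entails (map (tr_form \<rho> \<sigma>) \<Phi>) (sub_prp (inst Zero) (small_nat Q))"
      using base inst_tr_form_num[of \<rho> LZero \<sigma> \<phi>] by (simp add: sub_small_nat Q_def)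
    show "S \<triangleright> NatT # \<Gamma> \<turnstile> Entails (small_nat Q # map (ren_prp Suc) (map (tr_form \<rho> \<sigma>) \<Phi>))
        (sub_prp (Var(0 := Sc (Var 0))) (small_nat Q))"
      using step unfolding map_ren_tr_form sub_small_nat Q'_def Q_def suc_tr_form .
  qed
qed

lemma induction_sound:
  assumes ok: "\<And>\<rho> \<sigma>. ind_ok S (small_nat (tr_form \<rho> \<sigma> \<phi>))" and env: "env S \<Gamma> \<rho> \<sigma>"
  shows "S \<triangleright> \<Gamma> \<turnstile> Entails (map (tr_form \<rho> \<sigma>) \<Phi>)
    (tr_form \<rho> \<sigma> (LImp (ind_base \<phi>) (LImp (ind_step \<phi>) (LAllN \<phi>))))"
proof -
  let ?\<Phi> = "ind_step \<phi> # ind_base \<phi> # \<Phi>"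
  \<comment> \<open>The rule \<open>ind\<close> concludes an instance, not a universal statement. It
    is therefore used over a context with one extra number, instantiated at that number and then
    generalized.\<close>
  note env1 = env_weaken[OF env]
  have "S \<triangleright> NatT # \<Gamma> \<turnstile> HasType (Var 0) NatT"
    using env_valid[OF env1] by (simp add: num_var_type)
  from induction_inst[OF ok env1 this, of ?\<Phi>]
  have "S \<triangleright> NatT # \<Gamma> \<turnstile> Entails (map (tr_form (Suc \<circ> \<rho>) (Suc \<circ> \<sigma>)) ?\<Phi>)
      (small_nat (tr_form (rup \<rho>) (Suc \<circ> \<sigma>) \<phi>))"
    unfolding inst_Var0_tr_form by simp
  then have "S \<triangleright> NatT # \<Gamma> \<turnstile> Entails (map (tr_form (Suc \<circ> \<rho>) (Suc \<circ> \<sigma>)) ?\<Phi>)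
      (tr_form (rup \<rho>) (Suc \<circ> \<sigma>) \<phi>)"
    using small_nat_correct[OF env_num(1)[OF env]] by (blast intro: ent_conv prp_sym)
  then have "S \<triangleright> \<Gamma> \<turnstile> Entails (map (tr_form \<rho> \<sigma>) ?\<Phi>) (tr_form \<rho> \<sigma> (LAllN \<phi>))"
    using derivable.allI[OF env_hyps[OF env, of ?\<Phi>]] unfolding map_ren_tr_form by simp
  then show ?thesis by (auto intro!: derivable.impI)
qed

section \<open>Soundness of the axioms and of deduction\<close>

lemma ACA0_sound:
  assumes "\<phi> \<in> ACA0" "S \<noteq> LTT_W" "env S \<Gamma> \<rho> \<sigma>"
  shows "S \<triangleright> \<Gamma> \<turnstile> Entails (map (tr_form \<rho> \<sigma>) \<Phi>) (tr_form \<rho> \<sigma> \<phi>)"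
proof -
  note valid = env_valid[OF assms(3)] and props = env_hyps[OF assms(3), of \<Phi>]
  have num: "num_var \<Gamma> (\<rho> x)" for x
    using assms(3) by (simp add: env_def)
  have var: "S \<triangleright> \<Gamma> \<turnstile> HasType (Var (\<rho> x)) NatT" for x
    using valid num by (rule num_var_type)
  have tm: "S \<triangleright> \<Gamma> \<turnstile> HasType (tr_term \<rho> t) NatT" for t
    using assms(3) by (rule env_term_type)
  have times_step:
    "S \<triangleright> T HNat # NatT # \<Gamma> \<turnstile> HasType (plus_tm (Var 0) (Var (Suc (Suc (\<rho> x))))) NatT" for x
    using valid num by (intro plus_type num_var_type valid_cons) simp_all
  from assms(1) show ?thesis
  proof cases
    case (suc_nonzero x)
    then show ?thesis using suc_nonzero_sound[OF assms(2) valid props num] by simp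
  next
    case (suc_inj x y)
    then show ?thesis using suc_inj_sound[OF valid props num num] by simp
  next
    case (add_zero x)
    show ?thesis
      using eq_of_termEq[OF valid props tm[of "LAdd (LVar x) LZero"]]
        EN_zero[OF valid var plus_step_type[OF valid], of x] add_zero
      by (simp add: plus_tm_def)
  next
    case (add_suc x y)
    show ?thesis
      using eq_of_termEq[OF valid props tm[of "LAdd (LVar x) (LSuc (LVar y))"]]
        EN_suc[OF valid var plus_step_type[OF valid] var, of x y] add_suc
      by (simp add: plus_tm_def)
  next
    case (mul_zero x)
    show ?thesis
      using eq_of_termEq[OF valid props tm[of "LMul (LVar x) LZero"]]
        EN_zero[OF valid zero[OF valid] times_step, of x] mul_zero
      by (simp add: times_tm_def)
  next
    case (mul_suc x y)
    show ?thesis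
      \<comment> \<open>The recursion step adds the first factor on the right, so unfolding gives
        \<open>x \<cdot> y + x\<close> in the order of the axiom, without commutativity.\<close>
      using eq_of_termEq[OF valid props tm[of "LMul (LVar x) (LSuc (LVar y))"]]
        EN_suc[OF valid zero[OF valid] times_step var, of x y] mul_suc
      by (simp add: times_tm_def)
  next
    case (comprehension \<phi>)
    then show ?thesis using comprehension_sound[OF _ _ assms(3)] by blast
  next
    case (set_induction X)
    \<comment> \<open>A membership has the form \<open>V P\<close> and contains no quantifier, which
      meets the restriction on induction in every system.\<close>
    have "ind_ok S (small_nat (tr_form \<rho> \<sigma> (LMem (LVar 0) X)))" for \<rho> \<sigma>
      by (cases S) (simp_all add: analytic_def)
    from induction_sound[OF this assms(3)] set_induction show ?thesis
      by simp
  qed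
qed

lemma ACA_sound:
  assumes "\<phi> \<in> ACA" "env LTT_0_star \<Gamma> \<rho> \<sigma>"
  shows "LTT_0_star \<triangleright> \<Gamma> \<turnstile> Entails (map (tr_form \<rho> \<sigma>) \<Phi>) (tr_form \<rho> \<sigma> \<phi>)"
proof (cases "\<phi> \<in> ACA0")
  case True
  then show ?thesis using assms(2) by (intro ACA0_sound) simp_all
next
  case False
  then obtain \<psi> where "\<phi> = LImp (ind_base \<psi>) (LImp (ind_step \<psi>) (LAllN \<psi>))"
    using assms(1) by (auto simp: ACA_def)
  then show ?thesis
    using induction_sound[OF _ assms(2), of \<psi> \<Phi>] by (simp add: analytic_small_nat)
qed

text \<open>Leaving the axioms open lets one induction on proofs serve both theories. They must hold
  under every interpretation because the quantifier rules change context and interpretation along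
  the proof.\<close>

theorem proves_sound:
  assumes ax: "\<And>\<phi> \<Gamma> \<rho> \<sigma> \<Phi>. \<phi> \<in> Ax \<Longrightarrow> env S \<Gamma> \<rho> \<sigma> \<Longrightarrow>
      S \<triangleright> \<Gamma> \<turnstile> Entails (map (tr_form \<rho> \<sigma>) \<Phi>) (tr_form \<rho> \<sigma> \<phi>)"
    and "proves Ax \<Phi> \<phi>" "env S \<Gamma> \<rho> \<sigma>"
  shows "S \<triangleright> \<Gamma> \<turnstile> Entails (map (tr_form \<rho> \<sigma>) \<Phi>) (tr_form \<rho> \<sigma> \<phi>)"
  using assms(2,3)
proof (induction arbitrary: \<Gamma> \<rho> \<sigma> rule: proves.induct)
  case (axm \<phi> \<Phi>)
  then show ?case using ax by blast
next
  case (hyp \<phi> \<Phi>)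
  then show ?case using env_hyps by (intro derivable.hyp) auto
next
  case (impI \<phi> \<Phi> \<psi>)
  from impI.IH[OF impI.prems] show ?case by (simp add: derivable.impI)
next
  case (impE \<Phi> \<phi> \<psi>)
  from impE.IH(1)[OF impE.prems] impE.IH(2)[OF impE.prems] show ?case
    by (auto intro: derivable.impE)
next
  case (botE \<Phi> \<phi>)
  from botE.IH[OF botE.prems] env_form_prop[OF botE.prems] show ?case
    by (auto intro: derivable.botE)
next
  case (dne \<Phi> \<phi>)
  from dne.IH[OF dne.prems] show ?case by (auto intro: derivable.dne)
next
  case (allNI \<Phi> \<phi>)
  have "map (tr_form (rup \<rho>) (Suc \<circ> \<sigma>)) (map (lsub_num (\<lambda>x. LVar (Suc x))) \<Phi>)
      = map (ren_prp Suc) (map (tr_form \<rho> \<sigma>) \<Phi>)"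
    by (simp add: ren_tr_form_num)
  with allNI.IH[OF env_num(1)[OF allNI.prems]] env_hyps[OF allNI.prems, of \<Phi>] show ?case
    by (simp only: tr_form.simps) (rule derivable.allI)
next
  case (allNE \<Phi> \<phi> t)
  from derivable.allE[OF allNE.IH[OF allNE.prems, unfolded tr_form.simps] env_term_type[OF allNE.prems, of t]]
  show ?case by (simp add: inst_tr_form_num)
next
  case (allSI \<Phi> \<phi>)
  have "map (tr_form (Suc \<circ> \<rho>) (rup \<sigma>)) (map (lren_set Suc) \<Phi>)
      = map (ren_prp Suc) (map (tr_form \<rho> \<sigma>) \<Phi>)"
    by (simp add: ren_tr_form_set)
  with allSI.IH[OF env_set[OF allSI.prems]] env_hyps[OF allSI.prems, of \<Phi>] show ?case
    by (simp only: tr_form.simps) (rule derivable.allI)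
next
  case (allSE \<Phi> \<phi> Y)
  have "S \<triangleright> \<Gamma> \<turnstile> HasType (Var (\<sigma> Y)) (SetT NatT)"
    using allSE.prems by (simp add: env_def set_var_type)
  from derivable.allE[OF allSE.IH[OF allSE.prems, unfolded tr_form.simps] this]
  show ?case by (simp add: inst_tr_form_set)
next
  case (eq_refl \<Phi> t)
  then show ?case using env_hyps[OF eq_refl, of \<Phi>]
    by (auto intro!: derivable.eq_refl simp: hasType_T_HNat_iff env_valid env_term_type)
next
  case (eq_subst \<Phi> s t \<phi>)
  \<comment> \<open>Substitution of equals judges its formula over \<open>T HNat\<close>, hence the
    second part of \<open>env_num\<close>.\<close>
  from derivable.subst[OF subst_ok_tr_form env_form_prop[OF env_num(2)[OF eq_subst.prems]]
      eq_subst.IH(1)[OF eq_subst.prems, unfolded tr_form.simps]] eq_subst.IH(2)[OF eq_subst.prems]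
  show ?case by (simp add: inst_tr_form_num)
qed

section \<open>Return to the given context\<close>

lemma arith_ctx_valid: "S \<triangleright> arith_ctx m n \<turnstile> Valid"
proof -
  have "S \<triangleright> replicate m NatT \<turnstile> Valid"
    by (induction m) (simp_all add: ctx_empty valid_cons)
  then have "S \<triangleright> replicate n (SetT NatT) @ replicate m NatT \<turnstile> Valid"
    by (induction n) (simp_all add: valid_cons)
  then show ?thesis by (simp add: arith_ctx_def)
qed

lemma arith_ctx_num_var: "x < m \<Longrightarrow> num_var (arith_ctx m n) (num_ix n x)"
  by (simp add: num_var_def arith_ctx_def num_ix_def nth_append)

lemma arith_ctx_set_var: "X < n \<Longrightarrow> set_var (arith_ctx m n) (set_ix X)"
  by (simp add: set_var_def arith_ctx_def set_ix_def nth_append)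

text \<open>
  Proofs may mention variables that are not free in the conclusion. These are interpreted by two
  dummy variables, for which \<open>0\<close> and the empty set are substituted at the end.
\<close>

lemma arith_ctx_sound:
  assumes ax: "\<And>\<phi> \<Gamma> \<rho> \<sigma> \<Phi>. \<phi> \<in> Ax \<Longrightarrow> env S \<Gamma> \<rho> \<sigma> \<Longrightarrow>
      S \<triangleright> \<Gamma> \<turnstile> Entails (map (tr_form \<rho> \<sigma>) \<Phi>) (tr_form \<rho> \<sigma> \<phi>)"
    and "proves Ax [] \<phi>" and fv: "fv_num \<phi> \<subseteq> {..<m}" "fv_set \<phi> \<subseteq> {..<n}"
  shows "S \<triangleright> arith_ctx m n \<turnstile> Entails [] (tr_form (num_ix n) set_ix \<phi>)"
proof -
  let ?\<Gamma> = "arith_ctx m n"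
  let ?E = "Compr NatT HBot"
  \<comment> \<open>The dummies stand at the head of the context, the set at index 0 and the number
    at index 1, so genuine variables move up by two.\<close>
  define \<rho> where "\<rho> x = (if x < m then Suc (Suc (num_ix n x)) else 1)" for x
  define \<sigma> where "\<sigma> X = (if X < n then Suc (Suc (set_ix X)) else 0)" for X
  define \<phi>' where "\<phi>' = tr_form \<rho> \<sigma> \<phi>"
  have "env S (SetT NatT # NatT # ?\<Gamma>) \<rho> \<sigma>"
    by (simp add: env_def \<rho>_def \<sigma>_def arith_ctx_valid valid_cons arith_ctx_num_var arith_ctx_set_var)
  from proves_sound[OF ax assms(2) this]
  have "S \<triangleright> SetT NatT # NatT # ?\<Gamma> \<turnstile> Entails [] \<phi>'"
    by (simp add: \<phi>'_def)
  then have "S \<triangleright> ?\<Gamma> \<turnstile> Entails [] (Forall NatT (Forall (SetT NatT) \<phi>'))"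
    by (intro derivable.allI) simp_all
  from derivable.allE[OF this zero[OF arith_ctx_valid]]
  have "S \<triangleright> ?\<Gamma> \<turnstile> Entails [] (Forall (SetT NatT) (sub_prp (up (inst Zero)) \<phi>'))"
    by simp
  moreover have "S \<triangleright> ?\<Gamma> \<turnstile> HasType ?E (SetT NatT)"
    by (intro compr hbot valid_cons arith_ctx_valid)
  ultimately have "S \<triangleright> ?\<Gamma> \<turnstile> Entails [] (sub_prp (inst ?E) (sub_prp (up (inst Zero)) \<phi>'))"
    by (rule derivable.allE)
  \<comment> \<open>Removing the number dummy lowers the genuine indices by one only, since the set
    dummy still occupies index 0; the next substitution removes that one.\<close>
  moreover have "sub_prp (up (inst Zero)) \<phi>' = tr_form (Suc \<circ> num_ix n) (Suc \<circ> set_ix) \<phi>"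
    unfolding \<phi>'_def
    using fv sub_tr_form[of \<phi> "up (inst Zero)" \<rho> "Suc \<circ> num_ix n" LVar \<sigma> "Suc \<circ> set_ix" "\<lambda>X. X"]
    by (force simp: \<rho>_def \<sigma>_def)
  moreover have "sub_prp (inst ?E) (tr_form (Suc \<circ> num_ix n) (Suc \<circ> set_ix) \<phi>)
      = tr_form (num_ix n) set_ix \<phi>"
    using sub_tr_form[of \<phi> "inst ?E" "Suc \<circ> num_ix n" "num_ix n" LVar "Suc \<circ> set_ix" set_ix "\<lambda>X. X"]
    by simp
  ultimately show ?thesis by simp
qed

theorem mainTheorem1:
  fixes m n :: nat and t :: lterm and \<phi> :: lform
  assumes "fv_term t \<subseteq> {..<m}"
    and "fv_num \<phi> \<subseteq> {..<m}"
    and "fv_set \<phi> \<subseteq> {..<n}"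
  shows "(LTT_W \<triangleright> arith_ctx m n \<turnstile> HasType (tr_term (num_ix n) t) NatT)
    \<and> (LTT_W \<triangleright> arith_ctx m n \<turnstile> IsProp (tr_form (num_ix n) set_ix \<phi>))
    \<and> (arithmetic \<phi> \<longrightarrow>
        (LTT_W \<triangleright> arith_ctx m n \<turnstile> IsSmall (tr_small (num_ix n) set_ix \<phi>))
        \<and> (LTT_W \<triangleright> arith_ctx m n \<turnstile>
            PropEq (V (tr_small (num_ix n) set_ix \<phi>)) (tr_form (num_ix n) set_ix \<phi>)))
    \<and> (proves ACA0 [] \<phi> \<longrightarrow>
        (LTT_0 \<triangleright> arith_ctx m n \<turnstile> Entails [] (tr_form (num_ix n) set_ix \<phi>)))
    \<and> (proves ACA [] \<phi> \<longrightarrow>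
        (LTT_0_star \<triangleright> arith_ctx m n \<turnstile> Entails [] (tr_form (num_ix n) set_ix \<phi>)))"
proof (intro conjI HOL.impI)
  have num: "num_var (arith_ctx m n) (num_ix n x)" if "x \<in> fv_term t \<or> x \<in> fv_num \<phi>" for x
    using that assms by (intro arith_ctx_num_var) auto
  have set: "set_var (arith_ctx m n) (set_ix X)" if "X \<in> fv_set \<phi>" for X
    using that assms by (intro arith_ctx_set_var) auto
  show "LTT_W \<triangleright> arith_ctx m n \<turnstile> HasType (tr_term (num_ix n) t) NatT"
    using num by (intro tr_term_type arith_ctx_valid) simp
  show "LTT_W \<triangleright> arith_ctx m n \<turnstile> IsProp (tr_form (num_ix n) set_ix \<phi>)"
    using num set by (intro tr_form_prop arith_ctx_valid) simp_all
  show "LTT_W \<triangleright> arith_ctx m n \<turnstile> IsSmall (tr_small (num_ix n) set_ix \<phi>)"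
    "LTT_W \<triangleright> arith_ctx m n \<turnstile>
      PropEq (V (tr_small (num_ix n) set_ix \<phi>)) (tr_form (num_ix n) set_ix \<phi>)"
    if "arithmetic \<phi>"
    using tr_small_correct[OF that arith_ctx_valid, of m n "num_ix n" set_ix] num set by simp_all
  show "LTT_0 \<triangleright> arith_ctx m n \<turnstile> Entails [] (tr_form (num_ix n) set_ix \<phi>)" if "proves ACA0 [] \<phi>"
    using ACA0_sound that assms(2,3) by (rule arith_ctx_sound) simp_all
  show "LTT_0_star \<triangleright> arith_ctx m n \<turnstile> Entails [] (tr_form (num_ix n) set_ix \<phi>)" if "proves ACA [] \<phi>"
    using ACA_sound that assms(2,3) by (rule arith_ctx_sound)
qed

end
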